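(* Let $(X_n)_n$ be a sequence of Banach spaces and $1\leq p<\infty$. Then $(\sum_{n=1}^{\infty}\oplus X_n)_p$ has property $p$-$(V^{*})$ if and only if each $X_n$ has property $p$-$(V^{*})$.
   Context: For $1\le p<\infty$, a sequence $(z_n)_n$ in a Banach space $Z$ is weakly $p$-summable if $\sum_{n}|\langle z^{*},z_n\rangle|^{p}<\infty$ for every $z^{*}\in Z^{*}$. A bounded subset $K$ of a Banach space $X$ is a $p$-$(V^{*})$ set if $\lim_{n}\sup_{x\in K}|\langle x_n^{*},x\rangle|=0$ for every weakly $p$-summable sequence $(x_n^{*})_n$ in $X^{*}$. A Banach space $X$ has property $p$-$(V^{*})$ (Pe{\l}czy\'nski's property $(V^* )$ of order $p$) if every $p$-$(V^{*})$ subset of $X$ is relatively weakly compact. $(\sum_{n}\oplus X_n)_p$ is the Banach space of all $x=(x_n)_n$ with $x_n\in X_n$ and $\|x\|=(\sum_n\|x_n\|^p)^{1/p}<\infty$. *)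

theory Defs
  imports "HOL-Analysis.Analysis"
begin

text \<open>The scalar field is the field of real or of complex numbers; the following class has
  exactly these two members, up to isometric isomorphism.\<close>

class rc_field = real_normed_field +
  assumes real_or_complex:
    "(\<forall>z. \<exists>a. z = a *\<^sub>R 1) \<or>
     (\<exists>i. i * i = - 1 \<and> (\<forall>z. \<exists>a b. z = a *\<^sub>R 1 + b *\<^sub>R i))"

instance real :: rc_field
  by standard auto

instance complex :: rc_field
proof
  have "z = Re z *\<^sub>R 1 + Im z *\<^sub>R \<i>" for z
    by (simp add: complex_eq_iff)
  then have "\<i> * \<i> = - 1 \<and> (\<forall>z. \<exists>a b. z = a *\<^sub>R 1 + b *\<^sub>R \<i>)"
    by (metis complex_i_mult_minus i_squared)
  then show "(\<forall>z::complex. \<exists>a. z = a *\<^sub>R 1) \<or>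
     (\<exists>i::complex. i * i = - 1 \<and> (\<forall>z. \<exists>a b. z = a *\<^sub>R 1 + b *\<^sub>R i))"
    by blast
qed

text \<open>The spaces of a sequence need not live on a common vector space, and the norm of an
  \<open>\<ell>\<^sub>p\<close>-sum depends on \<open>p\<close>, so Banach spaces are represented by structures with an explicit
  carrier rather than by type classes. Nothing is assumed about the operations outside the
  carrier.\<close>

record ('k, 'a) nspace =
  vcarrier :: "'a set"
  vzero :: 'a
  vadd :: "'a \<Rightarrow> 'a \<Rightarrow> 'a"
  vscale :: "'k \<Rightarrow> 'a \<Rightarrow> 'a"
  vnorm :: "'a \<Rightarrow> real"

definition vdist :: "('k::rc_field, 'a) nspace \<Rightarrow> 'a \<Rightarrow> 'a \<Rightarrow> real" where
  "vdist X x y = vnorm X (vadd X x (vscale X (- 1) y))"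

locale normed_space =
  fixes X :: "('k::rc_field, 'a) nspace"
  assumes zero_closed: "vzero X \<in> vcarrier X"
    and add_closed: "x \<in> vcarrier X \<Longrightarrow> y \<in> vcarrier X \<Longrightarrow> vadd X x y \<in> vcarrier X"
    and scale_closed: "x \<in> vcarrier X \<Longrightarrow> vscale X c x \<in> vcarrier X"
    and add_assoc: "x \<in> vcarrier X \<Longrightarrow> y \<in> vcarrier X \<Longrightarrow> z \<in> vcarrier X \<Longrightarrow>
      vadd X (vadd X x y) z = vadd X x (vadd X y z)"
    and add_commute: "x \<in> vcarrier X \<Longrightarrow> y \<in> vcarrier X \<Longrightarrow> vadd X x y = vadd X y x"
    and add_zero: "x \<in> vcarrier X \<Longrightarrow> vadd X x (vzero X) = x"
    and add_inverse: "x \<in> vcarrier X \<Longrightarrow> \<exists>y\<in>vcarrier X. vadd X x y = vzero X"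
    and scale_add_right: "x \<in> vcarrier X \<Longrightarrow> y \<in> vcarrier X \<Longrightarrow>
      vscale X c (vadd X x y) = vadd X (vscale X c x) (vscale X c y)"
    and scale_add_left: "x \<in> vcarrier X \<Longrightarrow>
      vscale X (c + d) x = vadd X (vscale X c x) (vscale X d x)"
    and scale_scale: "x \<in> vcarrier X \<Longrightarrow> vscale X c (vscale X d x) = vscale X (c * d) x"
    and scale_one: "x \<in> vcarrier X \<Longrightarrow> vscale X 1 x = x"
    and norm_nonneg: "x \<in> vcarrier X \<Longrightarrow> 0 \<le> vnorm X x"
    and norm_eq_zero: "x \<in> vcarrier X \<Longrightarrow> vnorm X x = 0 \<longleftrightarrow> x = vzero X"
    and norm_scale: "x \<in> vcarrier X \<Longrightarrow> vnorm X (vscale X c x) = norm c * vnorm X x"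
    and norm_triangle: "x \<in> vcarrier X \<Longrightarrow> y \<in> vcarrier X \<Longrightarrow>
      vnorm X (vadd X x y) \<le> vnorm X x + vnorm X y"

locale banach_space = normed_space X for X :: "('k::rc_field, 'a) nspace" +
  assumes complete:
    "(\<And>n. s n \<in> vcarrier X) \<Longrightarrow>
     (\<And>e. 0 < e \<Longrightarrow> \<exists>N. \<forall>m\<ge>N. \<forall>n\<ge>N. vdist X (s m) (s n) < e) \<Longrightarrow>
     \<exists>l\<in>vcarrier X. (\<lambda>n. vdist X (s n) l) \<longlonglongrightarrow> 0"

text \<open>A functional on \<open>X\<close> is a function on the whole underlying type; requiring it to vanish
  off the carrier makes the representation unique, and the operations are then pointwise.\<close>

definition dual :: "('k::rc_field, 'a) nspace \<Rightarrow> ('k, 'a \<Rightarrow> 'k) nspace" where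
  "dual X =
    \<lparr>vcarrier = {f.
        (\<forall>x. x \<notin> vcarrier X \<longrightarrow> f x = 0) \<and>
        (\<forall>x\<in>vcarrier X. \<forall>y\<in>vcarrier X. f (vadd X x y) = f x + f y) \<and>
        (\<forall>x\<in>vcarrier X. \<forall>c. f (vscale X c x) = c * f x) \<and>
        (\<exists>B. \<forall>x\<in>vcarrier X. norm (f x) \<le> B * vnorm X x)},
     vzero = (\<lambda>x. 0),
     vadd = (\<lambda>f g x. f x + g x),
     vscale = (\<lambda>c f x. c * f x),
     vnorm = (\<lambda>f. SUP x\<in>{x \<in> vcarrier X. vnorm X x \<le> 1}. norm (f x))\<rparr>"

definition weakly_p_summable :: "real \<Rightarrow> ('k::rc_field, 'a) nspace \<Rightarrow> (nat \<Rightarrow> 'a) \<Rightarrow> bool" where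
  "weakly_p_summable p Z z \<longleftrightarrow>
    (\<forall>n. z n \<in> vcarrier Z) \<and>
    (\<forall>f\<in>vcarrier (dual Z). summable (\<lambda>n. norm (f (z n)) powr p))"

text \<open>The supremum is taken in \<^typ>\<open>ennreal\<close>, so that it is \<open>0\<close> for \<open>K = {}\<close>.\<close>

definition p_Vstar_set :: "real \<Rightarrow> ('k::rc_field, 'a) nspace \<Rightarrow> 'a set \<Rightarrow> bool" where
  "p_Vstar_set p X K \<longleftrightarrow>
    K \<subseteq> vcarrier X \<and>
    (\<exists>B. \<forall>x\<in>K. vnorm X x \<le> B) \<and>
    (\<forall>f. weakly_p_summable p (dual X) f \<longrightarrow>
      (\<lambda>n. SUP x\<in>K. ennreal (norm (f n x))) \<longlonglongrightarrow> 0)"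

definition weak_topology :: "('k::rc_field, 'a) nspace \<Rightarrow> 'a topology" where
  "weak_topology X = topology_generated_by
    {{x \<in> vcarrier X. f x \<in> U} | f U. f \<in> vcarrier (dual X) \<and> open U}"

definition relatively_weakly_compact :: "('k::rc_field, 'a) nspace \<Rightarrow> 'a set \<Rightarrow> bool" where
  "relatively_weakly_compact X K \<longleftrightarrow>
    K \<subseteq> vcarrier X \<and> compactin (weak_topology X) (weak_topology X closure_of K)"

definition property_p_Vstar :: "real \<Rightarrow> ('k::rc_field, 'a) nspace \<Rightarrow> bool" where
  "property_p_Vstar p X \<longleftrightarrow> (\<forall>K. p_Vstar_set p X K \<longrightarrow> relatively_weakly_compact X K)"

definition lp_sum :: "real \<Rightarrow> (nat \<Rightarrow> ('k::rc_field, 'a) nspace) \<Rightarrow> ('k, nat \<Rightarrow> 'a) nspace" where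
  "lp_sum p X =
    \<lparr>vcarrier = {x. (\<forall>n. x n \<in> vcarrier (X n)) \<and> summable (\<lambda>n. vnorm (X n) (x n) powr p)},
     vzero = (\<lambda>n. vzero (X n)),
     vadd = (\<lambda>x y n. vadd (X n) (x n) (y n)),
     vscale = (\<lambda>c x n. vscale (X n) c (x n)),
     vnorm = (\<lambda>x. (\<Sum>n. vnorm (X n) (x n) powr p) powr (1 / p))\<rparr>"

end

theory Submission
  imports Defs
begin

text \<open>
  Write \<open>Y\<close> for the \<open>\<ell>\<^sub>p\<close>-sum. The coordinate maps \<open>Y \<rightarrow> X\<^sub>n\<close> and the embeddings \<open>X\<^sub>n \<rightarrow> Y\<close> are
  bounded operators, and bounded operators map \<open>p\<close>-(V*) sets to \<open>p\<close>-(V*) sets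
  (\<open>p_Vstar_set_image\<close>) and are weakly continuous. If \<open>Y\<close> has the property, then a \<open>p\<close>-(V*) set of
  \<open>X\<^sub>n\<close>, embedded in \<open>Y\<close>, is relatively weakly compact, and this is inherited by its image under the
  coordinate map, which is the original set (\<open>relatively_weakly_compact_coordinate\<close>).

  Conversely, let every \<open>X\<^sub>n\<close> have the property and let \<open>K\<close> be a \<open>p\<close>-(V*) set of \<open>Y\<close>. Its coordinate
  projections are \<open>p\<close>-(V*) sets, hence relatively weakly compact. By Tychonoff's theorem the closure
  \<open>S\<close> of \<open>K\<close> for coordinatewise weak convergence is compact. It has to be shown that \<open>S\<close> lies in \<open>Y\<close>
  and that on \<open>S\<close> every functional \<open>f\<close> on \<open>Y\<close> is coordinatewise continuous; then \<open>S\<close> is the weak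
  closure of \<open>K\<close>, and compact (\<open>relatively_weakly_compact_lp_sum\<close>).

  As \<open>K\<close> is bounded, the first claim is the lower semicontinuity of the norm
  (\<open>coordinatewise_closure_subset\<close>), which uses functionals norming the coordinates and hence a
  Hahn--Banach theorem, obtained here by minimizing sublinear functionals
  (\<open>exists_norming_functional\<close>). For the second, \<open>f\<close> is the sum of its restrictions to the summands
  (\<open>functional_sums\<close>), and it is enough that this series converges uniformly on \<open>K\<close>
  (\<open>uniform_tails\<close>). This is a gliding hump argument, using that \<open>K\<close> is a \<open>p\<close>-(V*) set of \<open>Y\<close> and
  not only that its projections are \<open>p\<close>-(V*) sets: otherwise there are disjoint finite blocks of
  coordinates such that the restrictions \<open>f\<^sub>j\<close> of \<open>f\<close> to them do not tend to \<open>0\<close> uniformly on \<open>K\<close>.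
  But \<open>\<parallel>\<Sum>j<J. c\<^sub>j f\<^sub>j\<parallel> \<le> \<parallel>f\<parallel>\<close> whenever all \<open>\<bar>c\<^sub>j\<bar> \<le> 1\<close>, as multiplying the coordinates by scalars
  in the unit ball is a contraction of \<open>Y\<close>. So \<open>(f\<^sub>j)\<close> is weakly \<open>1\<close>-summable and therefore weakly
  \<open>p\<close>-summable (\<open>weakly_p_summable_blocks\<close>), a contradiction. The argument is the same for \<open>p = 1\<close>
  and \<open>p > 1\<close>.
\<close>

section \<open>Norming functionals over the real or complex scalars\<close>

context normed_space
begin

abbreviation V where "V \<equiv> vcarrier X"
abbreviation add (infixl \<open>\<oplus>\<close> 65) where "x \<oplus> y \<equiv> vadd X x y"
abbreviation scale (infixr \<open>\<odot>\<close> 75) where "c \<odot> x \<equiv> vscale X c x"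

lemmas closed [simp, intro] = zero_closed add_closed scale_closed

lemma add_left_commute:
  "x \<in> V \<Longrightarrow> y \<in> V \<Longrightarrow> z \<in> V \<Longrightarrow> x \<oplus> (y \<oplus> z) = y \<oplus> (x \<oplus> z)"
  by (metis add_assoc add_commute)

lemmas add_ac = add_assoc add_commute add_left_commute

lemma scale_zero_left [simp]: "x \<in> V \<Longrightarrow> 0 \<odot> x = vzero X"
proof -
  assume x: "x \<in> V"
  then obtain y where y: "y \<in> V" "x \<oplus> y = vzero X"
    using add_inverse by blast
  have "0 \<odot> x = 0 \<odot> x \<oplus> (x \<oplus> y)"
    using x y by (simp add: add_zero)
  also have "\<dots> = (0 \<odot> x \<oplus> 1 \<odot> x) \<oplus> y"
    using x y by (simp add: add_assoc scale_one)
  also have "\<dots> = x \<oplus> y"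
    using scale_add_left [OF x, of 0 1] x by (simp add: scale_one)
  finally show ?thesis using y by simp
qed

lemma scale_zero_right [simp]: "c \<odot> vzero X = vzero X"
  using scale_scale [of "vzero X" c 0] by simp

lemma add_uminus: "x \<in> V \<Longrightarrow> x \<oplus> (- 1) \<odot> x = vzero X"
  using scale_add_left [of x 1 "- 1"] by (simp add: scale_one)

definition sublinear :: "('a \<Rightarrow> real) \<Rightarrow> bool" where
  "sublinear q \<longleftrightarrow>
    (\<forall>x\<in>V. \<forall>y\<in>V. q (x \<oplus> y) \<le> q x + q y) \<and>
    (\<forall>x\<in>V. \<forall>t\<ge>0. q (of_real t \<odot> x) \<le> t * q x)"

lemma sublinear_add: "sublinear q \<Longrightarrow> x \<in> V \<Longrightarrow> y \<in> V \<Longrightarrow> q (x \<oplus> y) \<le> q x + q y"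
  by (simp add: sublinear_def)

lemma sublinear_zero: "sublinear q \<Longrightarrow> q (vzero X) = 0"
  using sublinear_add [of q "vzero X" "vzero X"]
  by (force simp: sublinear_def add_zero dest: bspec [of _ _ "vzero X"])

lemma sublinear_scale:
  assumes "sublinear q" "x \<in> V" "0 \<le> t"
  shows "q (of_real t \<odot> x) = t * q x"
proof (cases "t = 0")
  case True
  with assms show ?thesis by (simp add: sublinear_zero)
next
  case False
  have "x = of_real (1 / t) \<odot> (of_real t \<odot> x)"
    using False assms by (simp add: scale_scale scale_one)
  then have "q x \<le> 1 / t * q (of_real t \<odot> x)"
    using assms by (metis scale_closed sublinear_def zero_le_divide_1_iff)
  moreover have "q (of_real t \<odot> x) \<le> t * q x"
    using assms by (simp add: sublinear_def)
  ultimately show ?thesis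
    using False assms by (simp add: field_simps)
qed

lemma sublinear_uminus:
  assumes "sublinear q" "x \<in> V"
  shows "- q ((- 1) \<odot> x) \<le> q x"
  using sublinear_add [OF assms(1,2), of "(- 1) \<odot> x"] sublinear_zero [OF assms(1)] assms(2)
  by (simp add: add_uminus)

lemma sublinear_norm: "sublinear (vnorm X)"
  by (simp add: sublinear_def norm_triangle norm_scale)

text \<open>The largest sublinear \<open>r \<le> q\<close> with \<open>r (- y) = - q y\<close>, that is, one that agrees with \<open>q\<close> at \<open>y\<close>
  and is linear on the line through \<open>y\<close>. It is used twice: to make the norm linear in the
  direction of the vector that is to be normed, and to see that a minimal sublinear functional is
  linear in every direction.\<close>

definition linearize :: "'a \<Rightarrow> ('a \<Rightarrow> real) \<Rightarrow> 'a \<Rightarrow> real" where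
  "linearize y q x = (INF t\<in>{0..}. q (x \<oplus> of_real t \<odot> y) - t * q y)"

lemma linearize_le:
  assumes q: "sublinear q" and x: "x \<in> V" and y: "y \<in> V" and "0 \<le> t"
  shows "linearize y q x \<le> q (x \<oplus> of_real t \<odot> y) - t * q y"
  unfolding linearize_def
proof (rule cINF_lower)
  show "bdd_below ((\<lambda>t. q (x \<oplus> of_real t \<odot> y) - t * q y) ` {0..})"
  proof (rule bdd_belowI2)
    fix t :: real assume t: "t \<in> {0..}"
    have "of_real t \<odot> y = (x \<oplus> of_real t \<odot> y) \<oplus> (- 1) \<odot> x"
      using x y add_uminus [OF x] by (simp add: add_ac) (metis add_left_commute add_zero closed(2,3))
    then have "t * q y \<le> q (x \<oplus> of_real t \<odot> y) + q ((- 1) \<odot> x)"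
      using sublinear_add [OF q, of "x \<oplus> of_real t \<odot> y" "(- 1) \<odot> x"]
        sublinear_scale [OF q y, of t] x y t by auto
    then show "- q ((- 1) \<odot> x) \<le> q (x \<oplus> of_real t \<odot> y) - t * q y" by simp
  qed
qed (use assms in simp)

lemma linearize_greatest:
  assumes "\<And>t. 0 \<le> t \<Longrightarrow> c \<le> q (x \<oplus> of_real t \<odot> y) - t * q y"
  shows "c \<le> linearize y q x"
  unfolding linearize_def by (rule cINF_greatest) (use assms in auto)

lemma linearize_below:
  assumes "sublinear q" "x \<in> V" "y \<in> V"
  shows "linearize y q x \<le> q x"
  using linearize_le [OF assms, of 0] assms by (simp add: add_zero)

lemma sublinear_linearize:
  assumes q: "sublinear q" and y: "y \<in> V"
  shows "sublinear (linearize y q)"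
  unfolding sublinear_def
proof (intro conjI ballI allI impI)
  fix x x' assume x: "x \<in> V" and x': "x' \<in> V"
  have *: "linearize y q (x \<oplus> x') \<le>
      (q (x \<oplus> of_real s \<odot> y) - s * q y) + (q (x' \<oplus> of_real t \<odot> y) - t * q y)"
    if "0 \<le> s" "0 \<le> t" for s t
  proof -
    have "(x \<oplus> x') \<oplus> of_real (s + t) \<odot> y = (x \<oplus> of_real s \<odot> y) \<oplus> (x' \<oplus> of_real t \<odot> y)"
      using x x' y by (simp add: scale_add_left add_ac)
    then show ?thesis
      using linearize_le [OF q, of "x \<oplus> x'" y "s + t"] that x x' y
        sublinear_add [OF q, of "x \<oplus> of_real s \<odot> y" "x' \<oplus> of_real t \<odot> y"]
      by (auto simp: algebra_simps)
  qed
  have "linearize y q (x \<oplus> x') - (q (x' \<oplus> of_real t \<odot> y) - t * q y) \<le> linearize y q x"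
    if "0 \<le> t" for t
    by (rule linearize_greatest) (use *[OF _ that] in \<open>fastforce simp: algebra_simps\<close>)
  then have "linearize y q (x \<oplus> x') - linearize y q x \<le> linearize y q x'"
    by (intro linearize_greatest) (force simp: algebra_simps)
  then show "linearize y q (x \<oplus> x') \<le> linearize y q x + linearize y q x'" by simp
next
  fix x and a :: real assume x: "x \<in> V" and a: "0 \<le> a"
  show "linearize y q (of_real a \<odot> x) \<le> a * linearize y q x"
  proof (cases "a = 0")
    case True
    then show ?thesis
      using linearize_below [OF q _ y, of "vzero X"] x sublinear_zero [OF q] by simp
  next
    case False
    have "linearize y q (of_real a \<odot> x) / a \<le> linearize y q x"
    proof (rule linearize_greatest)
      fix t :: real assume t: "0 \<le> t"
      have "of_real a \<odot> x \<oplus> of_real (a * t) \<odot> y = of_real a \<odot> (x \<oplus> of_real t \<odot> y)"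
        using x y by (simp add: scale_add_right scale_scale)
      then have "linearize y q (of_real a \<odot> x) \<le> a * q (x \<oplus> of_real t \<odot> y) - a * t * q y"
        using linearize_le [OF q, of "of_real a \<odot> x" y "a * t"] x y a t
          sublinear_scale [OF q, of "x \<oplus> of_real t \<odot> y" a] by auto
      then show "linearize y q (of_real a \<odot> x) / a \<le> q (x \<oplus> of_real t \<odot> y) - t * q y"
        using False a by (simp add: field_simps)
    qed
    then show ?thesis
      using False a by (simp add: field_simps)
  qed
qed

text \<open>Zorn's lemma applies because a sublinear \<open>q \<le> p\<close> satisfies \<open>q x \<ge> - p (- x)\<close>, so that the
  infimum of a chain is finite; it is again sublinear because the members of a chain are
  comparable.\<close>

lemma exists_minimal_sublinear:
  assumes p: "sublinear p"
  obtains q where "sublinear q" "\<And>x. x \<in> V \<Longrightarrow> q x \<le> p x"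
    "\<And>r x. sublinear r \<Longrightarrow> (\<And>x. x \<in> V \<Longrightarrow> r x \<le> q x) \<Longrightarrow> x \<in> V \<Longrightarrow> r x = q x"
proof -
  define below where "below q r \<longleftrightarrow> (\<forall>x\<in>V. r x \<le> q x)" for q r :: "'a \<Rightarrow> real"
  \<comment> \<open>Prescribing the values off the carrier makes the pointwise order antisymmetric.\<close>
  define Q where "Q = {q. sublinear q \<and> below p q \<and> (\<forall>x. x \<notin> V \<longrightarrow> q x = 0)}"
  define cut where "cut q x = (if x \<in> V then q x else 0)" for q :: "'a \<Rightarrow> real" and x
  have cut: "sublinear (cut q)" if "sublinear q" for q
    using that by (simp add: sublinear_def cut_def)
  have "partial_order_on Q (relation_of below Q)"
  proof (rule partial_order_on_relation_ofI)
    show "a = b" if "a \<in> Q" "b \<in> Q" "below a b" "below b a" for a b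
    proof
      fix x show "a x = b x"
        using that by (cases "x \<in> V") (auto simp: below_def Q_def intro: antisym)
    qed
  qed (force simp: below_def)+
  moreover have "\<exists>u\<in>Q. \<forall>a\<in>C. below a u" if C: "C \<in> Chains (relation_of below Q)" for C
  proof (cases "C = {}")
    case True
    have "cut p \<in> Q"
      using cut [OF p] by (simp add: Q_def below_def cut_def)
    with True show ?thesis by blast
  next
    case False
    have CQ: "q \<in> Q" if "q \<in> C" for q
      using C that by (auto simp: Chains_def relation_of_def)
    have cmp: "below q r \<or> below r q" if "q \<in> C" "r \<in> C" for q r
      using C that by (auto simp: Chains_def relation_of_def)
    define u where "u x = (if x \<in> V then INF q\<in>C. q x else 0)" for x
    have bdd: "bdd_below ((\<lambda>q. q x) ` C)" if x: "x \<in> V" for x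
    proof (rule bdd_belowI2)
      fix q assume "q \<in> C"
      then have "sublinear q" "q ((- 1) \<odot> x) \<le> p ((- 1) \<odot> x)"
        using CQ x by (auto simp: Q_def below_def)
      then show "- p ((- 1) \<odot> x) \<le> q x"
        using sublinear_uminus [of q x] x by linarith
    qed
    have u_le: "u x \<le> q x" if "x \<in> V" "q \<in> C" for x q
      using cINF_lower [OF bdd that(2)] that by (simp add: u_def)
    have u_ge: "c \<le> u x" if "x \<in> V" "\<And>q. q \<in> C \<Longrightarrow> c \<le> q x" for c x
      using that False by (simp add: u_def cINF_greatest)
    have "sublinear u"
      unfolding sublinear_def
    proof (intro conjI ballI allI impI)
      fix x y assume x: "x \<in> V" and y: "y \<in> V"
      have *: "u (x \<oplus> y) \<le> q x + r y" if qr: "q \<in> C" "r \<in> C" for q r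
      proof -
        obtain s where s: "s \<in> C" "s x \<le> q x" "s y \<le> r y"
          using cmp [OF qr] x y qr by (auto simp: below_def)
        then have "u (x \<oplus> y) \<le> s x + s y"
          using u_le [of "x \<oplus> y" s] x y CQ [of s] sublinear_add [of s x y] by (auto simp: Q_def)
        with s show ?thesis by linarith
      qed
      have "u (x \<oplus> y) - r y \<le> u x" if "r \<in> C" for r
        by (rule u_ge [OF x]) (use * that in \<open>force simp: algebra_simps\<close>)
      then have "u (x \<oplus> y) - u x \<le> u y"
        by (intro u_ge [OF y]) (force simp: algebra_simps)
      then show "u (x \<oplus> y) \<le> u x + u y" by simp
    next
      fix x and t :: real assume x: "x \<in> V" and t: "0 \<le> t"
      have *: "u (of_real t \<odot> x) \<le> t * q x" if "q \<in> C" for q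
        using u_le [of "of_real t \<odot> x" q] that x CQ [of q] sublinear_scale [of q x t] t
        by (auto simp: Q_def)
      show "u (of_real t \<odot> x) \<le> t * u x"
      proof (cases "t = 0")
        case True
        then show ?thesis using * False by auto
      next
        case nz: False
        have "u (of_real t \<odot> x) / t \<le> u x"
          by (rule u_ge [OF x]) (use * nz t in \<open>force simp: field_simps\<close>)
        then show ?thesis using nz t by (simp add: field_simps)
      qed
    qed
    moreover have "below p u"
    proof -
      obtain q where "q \<in> C" using False by blast
      then show ?thesis
        using u_le [of _ q] CQ [of q] unfolding Q_def below_def
        by (metis (mono_tags, lifting) mem_Collect_eq order_trans)
    qed
    ultimately have "u \<in> Q"
      by (simp add: Q_def u_def)
    then show ?thesis
      using u_le by (auto simp: below_def)
  qed
  ultimately obtain m where m: "m \<in> Q" and max: "\<And>a. a \<in> Q \<Longrightarrow> below m a \<Longrightarrow> a = m"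
    using predicate_Zorn [of Q below] by blast
  show thesis
  proof (rule that [of m])
    fix r x assume r: "sublinear r" "\<And>x. x \<in> V \<Longrightarrow> r x \<le> m x" and x: "x \<in> V"
    have "cut r \<in> Q"
      using cut [OF r(1)] m r(2) by (auto simp: Q_def below_def cut_def intro: order_trans)
    then have "cut r = m"
      using max r(2) by (simp add: below_def cut_def)
    then show "r x = m x"
      using x by (metis cut_def)
  qed (use m in \<open>auto simp: Q_def below_def\<close>)
qed

text \<open>A minimal sublinear \<open>u\<close> below \<open>linearize z p\<close> is additive, for \<open>linearize y u \<le> u\<close> must be an
  equality for every \<open>y\<close>. Its value at \<open>z\<close> is forced because
  \<open>linearize z p (- z) \<le> p (- z + z) - p z = - p z\<close>.\<close>

lemma real_Hahn_Banach:
  assumes p: "sublinear p" and z: "z \<in> V"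
  obtains u where "\<And>x y. x \<in> V \<Longrightarrow> y \<in> V \<Longrightarrow> u (x \<oplus> y) = u x + u y"
    "\<And>t x. x \<in> V \<Longrightarrow> u (of_real t \<odot> x) = t * u x"
    "\<And>x. x \<in> V \<Longrightarrow> u x \<le> p x" "u z = p z"
proof -
  obtain u where u: "sublinear u" and le: "\<And>x. x \<in> V \<Longrightarrow> u x \<le> linearize z p x"
    and min: "\<And>r x. sublinear r \<Longrightarrow> (\<And>x. x \<in> V \<Longrightarrow> r x \<le> u x) \<Longrightarrow> x \<in> V \<Longrightarrow> r x = u x"
    using exists_minimal_sublinear [OF sublinear_linearize [OF p z]] by blast
  have add: "u (x \<oplus> y) = u x + u y" if x: "x \<in> V" and y: "y \<in> V" for x y
  proof -
    have "u x = linearize y u x"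
      using min [OF sublinear_linearize [OF u y] _ x] linearize_below [OF u _ y] by simp
    also have "\<dots> \<le> u (x \<oplus> y) - u y"
      using linearize_le [OF u x y, of 1] y by (simp add: scale_one)
    finally show ?thesis
      using sublinear_add [OF u x y] by simp
  qed
  have minus: "u ((- 1) \<odot> x) = - u x" if x: "x \<in> V" for x
    using add [of x "(- 1) \<odot> x"] x sublinear_zero [OF u] by (simp add: add_uminus)
  show thesis
  proof (rule that [of u])
    fix t x assume x: "x \<in> V"
    show "u (of_real t \<odot> x) = t * u x"
    proof (cases "0 \<le> t")
      case True
      then show ?thesis using sublinear_scale [OF u x] by simp
    next
      case False
      have "of_real t \<odot> x = (- 1) \<odot> (of_real (- t) \<odot> x)"
        using x by (simp add: scale_scale)
      then show ?thesis
        using False x sublinear_scale [OF u x, of "- t"] minus [of "of_real (- t) \<odot> x"] by simp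
    qed
  next
    show le': "u x \<le> p x" if "x \<in> V" for x
      using le [OF that] linearize_below [OF p that z] by linarith
    have "u ((- 1) \<odot> z) \<le> p ((- 1) \<odot> z \<oplus> z) - p z"
      using le [of "(- 1) \<odot> z"] linearize_le [OF p, of "(- 1) \<odot> z" z 1] z
      by (simp add: scale_one)
    also have "\<dots> = - p z"
      using add_uminus [OF z] z sublinear_zero [OF p] by (simp add: add_commute)
    finally show "u z = p z"
      using minus [OF z] le' [OF z] by simp
  qed (use add in blast)
qed

end

text \<open>A multiplicative norm on a copy of the complex numbers is the modulus, which dominates the
  real part. Indeed, it is at most twice the modulus, hence at most the modulus by comparing high
  powers, and the reverse inequality follows by passing to the inverse.\<close>

lemma norm_imaginary_combination:
  fixes i :: "'k::real_normed_field"
  assumes i: "i * i = - 1"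
  shows "\<bar>a\<bar> \<le> norm (of_real a + of_real b * i)"
proof -
  define \<phi> where "\<phi> w = of_real (Re w) + of_real (Im w) * i" for w
  have mult: "\<phi> (v * w) = \<phi> v * \<phi> w" for v w
  proof -
    have "\<phi> v * \<phi> w = of_real (Re v * Re w) + of_real (Re v * Im w + Im v * Re w) * i
        + of_real (Im v * Im w) * (i * i)"
      by (simp add: \<phi>_def algebra_simps)
    then show ?thesis
      by (simp add: i \<phi>_def algebra_simps)
  qed
  have one: "\<phi> 1 = 1"
    by (simp add: \<phi>_def)
  have power: "\<phi> (w ^ n) = \<phi> w ^ n" for w n
    by (induction n) (simp_all add: one mult)
  have "norm i * norm i = 1"
    by (metis i norm_minus_cancel norm_mult norm_one)
  then have "norm i = 1"
    by (metis abs_norm_cancel abs_square_eq_1 power2_eq_square)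
  then have crude: "norm (\<phi> w) \<le> 2 * cmod w" for w
    using norm_triangle_ineq [of "of_real (Re w) :: 'k" "of_real (Im w) * i"]
      abs_Re_le_cmod [of w] abs_Im_le_cmod [of w]
    by (simp add: \<phi>_def norm_mult)
  have sharp: "norm (\<phi> w) \<le> cmod w" if w: "w \<noteq> 0" for w
  proof (rule ccontr)
    assume "\<not> ?thesis"
    then have "1 < norm (\<phi> w) / cmod w"
      using w by simp
    then obtain n where "2 < (norm (\<phi> w) / cmod w) ^ n"
      using real_arch_pow by blast
    then have "2 * cmod (w ^ n) < norm (\<phi> (w ^ n))"
      using w by (simp add: power norm_power field_simps)
    with crude show False
      by (meson not_le)
  qed
  show ?thesis
  proof (cases "Complex a b = 0")
    case True
    then show ?thesis by (auto simp: complex_eq_iff)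
  next
    case False
    let ?w = "Complex a b"
    have "\<phi> ?w * \<phi> (inverse ?w) = 1"
      using False by (simp flip: mult add: one)
    then have "1 = norm (\<phi> ?w) * norm (\<phi> (inverse ?w))"
      by (metis norm_mult norm_one)
    also have "\<dots> \<le> norm (\<phi> ?w) * cmod (inverse ?w)"
      using sharp [of "inverse ?w"] False by (intro mult_left_mono) auto
    finally have "1 \<le> norm (\<phi> ?w) / cmod ?w"
      by (simp only: norm_inverse divide_inverse)
    then have "cmod ?w \<le> norm (\<phi> ?w)"
      using False by (simp add: le_divide_eq)
    moreover have "\<bar>a\<bar> \<le> cmod ?w"
      using abs_Re_le_cmod [of ?w] by simp
    ultimately show ?thesis
      by (simp add: \<phi>_def)
  qed
qed

lemma scalar_to_norm:
  fixes w :: "'k::real_normed_field"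
  obtains c :: 'k where "norm c = 1" "c * w = of_real (norm w)"
proof (cases "w = 0")
  case True
  then show ?thesis using that [of 1] by simp
next
  case False
  then show ?thesis using that [of "of_real (norm w) / w"] by (simp add: norm_divide)
qed

lemma dualI:
  assumes "\<And>x. x \<notin> vcarrier X \<Longrightarrow> f x = 0"
    and "\<And>x y. x \<in> vcarrier X \<Longrightarrow> y \<in> vcarrier X \<Longrightarrow> f (vadd X x y) = f x + f y"
    and "\<And>c x. x \<in> vcarrier X \<Longrightarrow> f (vscale X c x) = c * f x"
    and "\<And>x. x \<in> vcarrier X \<Longrightarrow> norm (f x) \<le> B * vnorm X x"
  shows "f \<in> vcarrier (dual X)"
  unfolding dual_def using assms by simp blast

lemma dualD:
  assumes "f \<in> vcarrier (dual X)"
  shows "x \<notin> vcarrier X \<Longrightarrow> f x = 0"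
    and "x \<in> vcarrier X \<Longrightarrow> y \<in> vcarrier X \<Longrightarrow> f (vadd X x y) = f x + f y"
    and "x \<in> vcarrier X \<Longrightarrow> f (vscale X c x) = c * f x"
  using assms by (auto simp: dual_def)

context normed_space
begin

lemma dual_bound:
  assumes "f \<in> vcarrier (dual X)"
  obtains B where "0 \<le> B" "\<And>x. x \<in> V \<Longrightarrow> norm (f x) \<le> B * vnorm X x"
proof -
  obtain B where B: "\<And>x. x \<in> V \<Longrightarrow> norm (f x) \<le> B * vnorm X x"
    using assms unfolding dual_def by simp blast
  show thesis
  proof (rule that [of "max B 0"])
    show "norm (f x) \<le> max B 0 * vnorm X x" if "x \<in> V" for x
      using B [OF that] norm_nonneg [OF that] by (meson max.cobounded1 mult_right_mono order_trans)
  qed simp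
qed

text \<open>Over the complex numbers, \<open>g x = u x - i * u (i * x)\<close> is linear when \<open>u\<close> is real-linear. If
  \<open>c\<close> turns \<open>g x\<close> into its norm, then \<open>g (c * x)\<close> has no imaginary part, so
  \<open>\<bar>g x\<bar> = u (c * x) \<le> \<parallel>x\<parallel>\<close>. Conversely \<open>\<bar>g z\<bar> \<ge> u z = \<parallel>z\<parallel>\<close>, and a rotation of \<open>g\<close> makes
  its value at \<open>z\<close> equal to \<open>\<parallel>z\<parallel>\<close>.\<close>

theorem exists_norming_functional:
  assumes z: "z \<in> V"
  obtains f where "f \<in> vcarrier (dual X)" "\<And>x. x \<in> V \<Longrightarrow> norm (f x) \<le> vnorm X x"
    "f z = of_real (vnorm X z)"
proof -
  obtain u where add: "\<And>x y. x \<in> V \<Longrightarrow> y \<in> V \<Longrightarrow> u (x \<oplus> y) = u x + u y"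
    and scale: "\<And>t x. x \<in> V \<Longrightarrow> u (of_real t \<odot> x) = t * u x"
    and le: "\<And>x. x \<in> V \<Longrightarrow> u x \<le> vnorm X x" and z_eq: "u z = vnorm X z"
    using real_Hahn_Banach [OF sublinear_norm z] by blast
  have abs_le: "\<bar>u x\<bar> \<le> vnorm X x" if x: "x \<in> V" for x
    using le [OF x] le [of "(- 1) \<odot> x"] scale [OF x, of "- 1"] norm_scale [OF x, of "- 1"] x
    by simp
  from real_or_complex show thesis
  proof
    assume real: "\<forall>c::'k. \<exists>a. c = a *\<^sub>R 1"
    define f :: "'a \<Rightarrow> 'k" where "f x = (if x \<in> V then of_real (u x) else 0)" for x
    have "f (c \<odot> x) = c * f x" if "x \<in> V" for c x
    proof -
      obtain a where "c = of_real a"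
        using real by (auto simp: of_real_def)
      then show ?thesis using that by (simp add: f_def scale)
    qed
    then have "f \<in> vcarrier (dual X)"
      by (intro dualI [of _ _ 1]) (auto simp: f_def add abs_le)
    then show thesis
      by (rule that) (use z z_eq in \<open>auto simp: f_def abs_le\<close>)
  next
    assume "\<exists>i::'k. i * i = - 1 \<and> (\<forall>c. \<exists>a b. c = a *\<^sub>R 1 + b *\<^sub>R i)"
    then obtain i :: 'k where i: "i * i = - 1" and "\<And>c. \<exists>a b. c = a *\<^sub>R 1 + b *\<^sub>R i"
      by blast
    then have combination: "\<exists>a b. c = of_real a + of_real b * i" for c
      by (metis scaleR_conv_of_real mult.right_neutral)
    \<comment> \<open>A complex-linear functional is recovered from its real part \<open>u\<close>.\<close>
    define g :: "'a \<Rightarrow> 'k" where "g x = of_real (u x) - of_real (u (i \<odot> x)) * i" for x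
    have g_add: "g (x \<oplus> y) = g x + g y" if "x \<in> V" "y \<in> V" for x y
      using that by (simp add: g_def scale_add_right add algebra_simps)
    have g_scale: "g (c \<odot> x) = c * g x" if x: "x \<in> V" for c x
    proof -
      obtain a b where c: "c = of_real a + of_real b * i"
        using combination by blast
      have "c \<odot> x = of_real a \<odot> x \<oplus> of_real b \<odot> (i \<odot> x)"
        using x by (simp add: c scale_add_left scale_scale)
      then have 1: "u (c \<odot> x) = a * u x + b * u (i \<odot> x)"
        using x by (simp add: add scale)
      have "i * c = of_real a * i + of_real (- b)"
        using arg_cong [OF i, of "\<lambda>t. of_real b * t"] by (simp add: c algebra_simps)
      then have "i \<odot> (c \<odot> x) = of_real a \<odot> (i \<odot> x) \<oplus> of_real (- b) \<odot> x"
        using x by (simp add: scale_add_left scale_scale del: of_real_minus add_uminus_conv_diff)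
      then have 2: "u (i \<odot> (c \<odot> x)) = a * u (i \<odot> x) - b * u x"
        using x by (simp add: add scale del: of_real_minus)
      have "c * g x = of_real (a * u x) + of_real (b * u x - a * u (i \<odot> x)) * i
          - of_real (b * u (i \<odot> x)) * (i * i)"
        by (simp add: g_def c algebra_simps)
      then show ?thesis
        by (simp add: i g_def 1 2 algebra_simps)
    qed
    have g_le: "norm (g x) \<le> vnorm X x" if x: "x \<in> V" for x
    proof -
      obtain c where c: "norm c = 1" "c * g x = of_real (norm (g x))"
        by (rule scalar_to_norm)
      then have "of_real (norm (g x) - u (c \<odot> x)) + of_real (u (i \<odot> (c \<odot> x))) * i = 0"
        using g_scale [OF x, of c] by (simp add: g_def [of "c \<odot> x"] algebra_simps)
      then have "norm (g x) = u (c \<odot> x)"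
        using norm_imaginary_combination [OF i] by (metis abs_le_zero_iff eq_iff_diff_eq_0 norm_zero)
      also have "\<dots> \<le> vnorm X x"
        using le [of "c \<odot> x"] x norm_scale [OF x, of c] c by simp
      finally show ?thesis .
    qed
    have "vnorm X z \<le> norm (g z)"
      using norm_imaginary_combination [OF i, of "u z" "- u (i \<odot> z)"] z_eq norm_nonneg [OF z]
      by (simp add: g_def)
    with g_le [OF z] have norm_gz: "norm (g z) = vnorm X z"
      by simp
    obtain c where c: "norm c = 1" "c * g z = of_real (norm (g z))"
      by (rule scalar_to_norm)
    define f where "f x = (if x \<in> V then c * g x else 0)" for x
    have "f \<in> vcarrier (dual X)"
      by (intro dualI [of _ _ 1])
        (auto simp: f_def g_add g_scale norm_mult c g_le algebra_simps)
    then show thesis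
      by (rule that) (use z c norm_gz in \<open>auto simp: f_def norm_mult g_le\<close>)
  qed
qed

end

section \<open>Bounded operators, the weak topology and \<open>p\<close>-(V*) sets\<close>

lemma dual_simps [simp]:
  "vzero (dual X) = (\<lambda>x. 0)"
  "vadd (dual X) = (\<lambda>f g x. f x + g x)"
  "vscale (dual X) = (\<lambda>c f x. c * f x)"
  by (simp_all add: dual_def)

context normed_space
begin

lemma norm_zero_vector: "vnorm X (vzero X) = 0"
  by (simp add: norm_eq_zero)

lemma dual_zero: "f \<in> vcarrier (dual X) \<Longrightarrow> f (vzero X) = 0"
  using dualD(3) [of f X "vzero X" 0] by simp

lemma dual_norm_le:
  assumes "0 \<le> B" "\<And>x. x \<in> V \<Longrightarrow> norm (f x) \<le> B * vnorm X x"
  shows "vnorm (dual X) f \<le> B"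
  unfolding dual_def
proof (simp, rule cSUP_least)
  show "{x \<in> V. vnorm X x \<le> 1} \<noteq> {}"
    using norm_zero_vector zero_closed by force
  fix x assume "x \<in> {x \<in> V. vnorm X x \<le> 1}"
  then show "norm (f x) \<le> B"
    using assms(2) [of x] mult_left_mono [of "vnorm X x" 1 B] assms(1) by auto
qed

lemma norm_le_dual_norm_unit:
  assumes f: "f \<in> vcarrier (dual X)" and "y \<in> V" "vnorm X y \<le> 1"
  shows "norm (f y) \<le> vnorm (dual X) f"
proof -
  obtain B where B: "0 \<le> B" "\<And>x. x \<in> V \<Longrightarrow> norm (f x) \<le> B * vnorm X x"
    using dual_bound [OF f] by blast
  have "bdd_above ((\<lambda>y. norm (f y)) ` {y \<in> V. vnorm X y \<le> 1})"
    by (rule bdd_aboveI2 [where M = B])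
      (use B mult_left_mono [of _ 1 B] in \<open>fastforce intro: order_trans\<close>)
  then show ?thesis
    using cSUP_upper [of y "{y \<in> V. vnorm X y \<le> 1}" "\<lambda>y. norm (f y)"] assms
    by (simp add: dual_def)
qed

lemma norm_le_dual_norm:
  assumes f: "f \<in> vcarrier (dual X)" and x: "x \<in> V"
  shows "norm (f x) \<le> vnorm (dual X) f * vnorm X x"
proof -
  obtain B where B: "0 \<le> B" "\<And>x. x \<in> V \<Longrightarrow> norm (f x) \<le> B * vnorm X x"
    using dual_bound [OF f] by blast
  show ?thesis
  proof (cases "vnorm X x = 0")
    case True
    then show ?thesis using B(2) [OF x] by simp
  next
    case False
    then have pos: "0 < vnorm X x"
      using norm_nonneg [OF x] by simp
    let ?y = "of_real (1 / vnorm X x) \<odot> x"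
    have "norm (f ?y) \<le> vnorm (dual X) f"
      using x pos by (intro norm_le_dual_norm_unit f) (simp_all add: norm_scale norm_divide)
    moreover have "norm (f ?y) = norm (f x) / vnorm X x"
      using pos by (simp only: dualD(3) [OF f x]) (simp add: norm_mult norm_divide)
    ultimately have "norm (f x) / vnorm X x \<le> vnorm (dual X) f"
      by simp
    then show ?thesis
      using pos by (simp add: pos_divide_le_eq)
  qed
qed

lemma dual_norm_nonneg: "f \<in> vcarrier (dual X) \<Longrightarrow> 0 \<le> vnorm (dual X) f"
  using norm_le_dual_norm_unit [of f "vzero X"] by (simp add: norm_zero_vector dual_zero)

lemma normed_space_dual: "normed_space (dual X)"
proof
  have zero_dual: "vzero (dual X) \<in> vcarrier (dual X)"
    by (rule dualI [of _ _ 0]) auto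
  then show "vzero (dual X) \<in> vcarrier (dual X)" .
  fix f g and c d :: 'k
  assume f: "f \<in> vcarrier (dual X)"
  note nf = norm_le_dual_norm [OF f] dual_norm_nonneg [OF f]
  have scale_closed: "vscale (dual X) c f \<in> vcarrier (dual X)" for c
    by (rule dualI [of _ _ "norm c * vnorm (dual X) f"])
      (use nf in \<open>auto simp: dualD [OF f] algebra_simps norm_mult mult_left_mono\<close>)
  then show "vscale (dual X) c f \<in> vcarrier (dual X)" .
  show "0 \<le> vnorm (dual X) f"
    by (fact nf)
  show "\<exists>g\<in>vcarrier (dual X). vadd (dual X) f g = vzero (dual X)"
    by (rule bexI [OF _ scale_closed [of "- 1"]]) simp
  have scale_le: "vnorm (dual X) (\<lambda>x. c * f x) \<le> norm c * vnorm (dual X) f"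
    if "f \<in> vcarrier (dual X)" for c f
    by (rule dual_norm_le)
      (use norm_le_dual_norm [OF that] dual_norm_nonneg [OF that] in
        \<open>auto simp: norm_mult mult.assoc mult_left_mono\<close>)
  show "vnorm (dual X) (vscale (dual X) c f) = norm c * vnorm (dual X) f"
  proof (cases "c = 0")
    case True
    then show ?thesis
      using dual_norm_le [of 0 "\<lambda>x. 0"] dual_norm_nonneg [OF zero_dual] by simp
  next
    case False
    then show ?thesis
      using scale_le [OF f, of c] scale_le [OF scale_closed [of c], of "1 / c"]
      by (simp add: norm_divide field_simps)
  qed
  show "vnorm (dual X) f = 0 \<longleftrightarrow> f = vzero (dual X)"
  proof
    assume 0: "vnorm (dual X) f = 0"
    have "f x = 0" for x
      using nf(1) [of x] 0 dualD(1) [OF f, of x] by (cases "x \<in> V") auto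
    then show "f = vzero (dual X)" by auto
  next
    show "f = vzero (dual X) \<Longrightarrow> vnorm (dual X) f = 0"
      using dual_norm_le [of 0 "\<lambda>x. 0"] dual_norm_nonneg [OF zero_dual] by simp
  qed
  assume g: "g \<in> vcarrier (dual X)"
  note ng = norm_le_dual_norm [OF g] dual_norm_nonneg [OF g]
  have sum_le: "norm (f x + g x) \<le> (vnorm (dual X) f + vnorm (dual X) g) * vnorm X x"
    if "x \<in> V" for x
    using norm_triangle_ineq [of "f x" "g x"] nf(1) [OF that] ng(1) [OF that]
    by (simp add: algebra_simps)
  show "vadd (dual X) f g \<in> vcarrier (dual X)"
    by (rule dualI [of _ _ "vnorm (dual X) f + vnorm (dual X) g"])
      (use sum_le in \<open>auto simp: dualD [OF f] dualD [OF g] algebra_simps\<close>)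
  show "vnorm (dual X) (vadd (dual X) f g) \<le> vnorm (dual X) f + vnorm (dual X) g"
    using sum_le nf ng by (simp add: dual_norm_le)
qed (auto simp: algebra_simps)

text \<open>Scalars \<open>c\<^sub>j\<close> that turn every \<open>\<phi> (f\<^sub>j)\<close> into its norm give
  \<open>\<Sum>j<J. \<bar>\<phi> (f\<^sub>j)\<bar> = \<phi> (\<Sum>j<J. c\<^sub>j f\<^sub>j) \<le> C * \<parallel>\<phi>\<parallel>\<close>. So the sequence is even weakly
  \<open>1\<close>-summable, which is stronger because its values tend to \<open>0\<close>.\<close>

lemma weakly_p_summable_dualI:
  assumes f: "\<And>j. f j \<in> vcarrier (dual X)" and C: "0 \<le> C" and p: "1 \<le> p"
    and bound: "\<And>c J x. (\<And>j. norm (c j) \<le> 1) \<Longrightarrow> x \<in> V \<Longrightarrow>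
      norm (\<Sum>j<J. c j * f j x) \<le> C * vnorm X x"
  shows "weakly_p_summable p (dual X) f"
  unfolding weakly_p_summable_def
proof (intro conjI allI ballI f)
  fix \<phi> assume \<phi>: "\<phi> \<in> vcarrier (dual (dual X))"
  interpret D: normed_space "dual X"
    by (rule normed_space_dual)
  have sum: "(\<lambda>x. \<Sum>j<J. c j * f j x) \<in> vcarrier (dual X)"
    "\<phi> (\<lambda>x. \<Sum>j<J. c j * f j x) = (\<Sum>j<J. c j * \<phi> (f j))" for c and J :: nat
  proof (induction J)
    case 0
    {
      case 1
      show ?case using D.zero_closed by simp
    next
      case 2
      show ?case using D.dual_zero [OF \<phi>] by simp
    }
  next
    case (Suc J)
    have cf: "(\<lambda>x. c J * f J x) \<in> vcarrier (dual X)" "\<phi> (\<lambda>x. c J * f J x) = c J * \<phi> (f J)"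
      using D.scale_closed [OF f] dualD(3) [OF \<phi> f] by simp_all
    {
      case 1
      show ?case using D.add_closed [OF Suc(1) cf(1)] by simp
    next
      case 2
      show ?case using dualD(2) [OF \<phi> Suc(1) cf(1)] by (simp add: Suc(2) cf(2))
    }
  qed
  define c where "c j = (SOME c. norm c = 1 \<and> c * \<phi> (f j) = of_real (norm (\<phi> (f j))))" for j
  have c: "norm (c j) = 1" "c j * \<phi> (f j) = of_real (norm (\<phi> (f j)))" for j
    unfolding c_def by (rule someI2_ex; metis scalar_to_norm)+
  have "(\<Sum>j<J. norm (\<phi> (f j))) \<le> vnorm (dual (dual X)) \<phi> * C" for J
  proof -
    have "(\<Sum>j<J. norm (\<phi> (f j))) = norm (\<Sum>j<J. c j * \<phi> (f j))"
      by (simp add: c(2) sum_nonneg flip: of_real_sum)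
    also have "\<dots> = norm (\<phi> (\<lambda>x. \<Sum>j<J. c j * f j x))"
      by (simp add: sum(2))
    also have "\<dots> \<le> vnorm (dual (dual X)) \<phi> * vnorm (dual X) (\<lambda>x. \<Sum>j<J. c j * f j x)"
      by (rule D.norm_le_dual_norm [OF \<phi> sum(1)])
    also have "\<dots> \<le> vnorm (dual (dual X)) \<phi> * C"
      by (intro mult_left_mono D.dual_norm_nonneg [OF \<phi>] dual_norm_le C bound) (simp_all add: c)
    finally show ?thesis .
  qed
  then have summable: "summable (\<lambda>j. norm (\<phi> (f j)))"
    by (intro summableI_nonneg_bounded) auto
  then have "eventually (\<lambda>j. norm (\<phi> (f j)) < 1) sequentially"
    by (rule order_tendstoD(2) [OF summable_LIMSEQ_zero]) simp
  then have "eventually (\<lambda>j. norm (norm (\<phi> (f j)) powr p) \<le> norm (\<phi> (f j))) sequentially"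
    by eventually_elim (use p powr_mono' [of 1 p] in auto)
  then show "summable (\<lambda>j. norm (\<phi> (f j)) powr p)"
    using summable by (rule summable_comparison_test_ev)
qed

lemma topspace_weak [simp]: "topspace (weak_topology X) = V"
proof -
  have "(\<lambda>x. 0) \<in> vcarrier (dual X)"
    using normed_space.zero_closed [OF normed_space_dual] by simp
  then have "{x \<in> V. (\<lambda>x. 0::'k) x \<in> UNIV} \<in> {{x \<in> V. f x \<in> U} | f U. f \<in> vcarrier (dual X) \<and> open U}"
    by blast
  then show ?thesis
    by (auto simp: weak_topology_def)
qed

lemma continuous_map_weak_functional:
  assumes "f \<in> vcarrier (dual X)"
  shows "continuous_map (weak_topology X) euclidean f"
  unfolding continuous_map_def topspace_weak
  using assms by (auto simp: weak_topology_def intro!: topology_generated_by_Basis)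

lemma continuous_map_into_weak:
  assumes "\<And>x. x \<in> topspace Z \<Longrightarrow> g x \<in> V"
    and "\<And>f. f \<in> vcarrier (dual X) \<Longrightarrow> continuous_map Z euclidean (\<lambda>x. f (g x))"
  shows "continuous_map Z (weak_topology X) g"
  unfolding weak_topology_def
proof (rule continuous_on_generated_topo)
  fix S assume "S \<in> {{x \<in> V. f x \<in> U} | f U. f \<in> vcarrier (dual X) \<and> open U}"
  then obtain f U where S: "S = {x \<in> V. f x \<in> U}" "f \<in> vcarrier (dual X)" "open U"
    by blast
  have "g -` S \<inter> topspace Z = {x \<in> topspace Z. f (g x) \<in> U}"
    using assms(1) by (auto simp: S(1))
  then show "openin Z (g -` S \<inter> topspace Z)"
    using openin_continuous_map_preimage [OF assms(2) [OF S(2)], of U] S(3) by simp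
next
  show "g ` topspace Z \<subseteq> \<Union> {{x \<in> V. f x \<in> U} | f U. f \<in> vcarrier (dual X) \<and> open U}"
    using assms(1) topspace_weak unfolding weak_topology_def topology_generated_by_topspace
    by blast
qed

end

lemma norm_le_on_closure:
  fixes G :: "'b \<Rightarrow> 'c::real_normed_vector"
  assumes G: "continuous_map T euclidean G" and K: "\<And>x. x \<in> K \<Longrightarrow> norm (G x) \<le> e"
    and z: "z \<in> T closure_of K"
  shows "norm (G z) \<le> e"
proof -
  have "G z \<in> euclidean closure_of (G ` K)"
    using continuous_map_image_closure_subset [OF G] z by blast
  also have "euclidean closure_of (G ` K) \<subseteq> cball 0 e"
    by (rule closure_of_minimal) (use K in auto)
  finally show ?thesis by simp
qed

definition bounded_operator ::
    "('k::rc_field, 'a) nspace \<Rightarrow> ('k, 'b) nspace \<Rightarrow> ('a \<Rightarrow> 'b) \<Rightarrow> bool" where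
  "bounded_operator X Y T \<longleftrightarrow>
    (\<forall>x\<in>vcarrier X. T x \<in> vcarrier Y) \<and>
    (\<forall>x\<in>vcarrier X. \<forall>y\<in>vcarrier X. T (vadd X x y) = vadd Y (T x) (T y)) \<and>
    (\<forall>x\<in>vcarrier X. \<forall>c. T (vscale X c x) = vscale Y c (T x)) \<and>
    (\<exists>B\<ge>0. \<forall>x\<in>vcarrier X. vnorm Y (T x) \<le> B * vnorm X x)"

text \<open>The value \<open>0\<close> off the carrier makes the pullback a member of the dual, whose elements vanish
  there. As an operator between dual spaces this is the adjoint of \<open>T\<close>.\<close>

definition pullback :: "('k::rc_field, 'a) nspace \<Rightarrow> ('a \<Rightarrow> 'b) \<Rightarrow> ('b \<Rightarrow> 'k) \<Rightarrow> 'a \<Rightarrow> 'k" where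
  "pullback X T f x = (if x \<in> vcarrier X then f (T x) else 0)"

locale normed_space_pair = X: normed_space X + Y: normed_space Y
  for X :: "('k::rc_field, 'a) nspace" and Y :: "('k, 'b) nspace"
begin

lemma pullback_in_dual:
  assumes T: "bounded_operator X Y T" and f: "f \<in> vcarrier (dual Y)"
  shows "pullback X T f \<in> vcarrier (dual X)"
proof -
  obtain B where B: "0 \<le> B" "\<And>x. x \<in> vcarrier X \<Longrightarrow> vnorm Y (T x) \<le> B * vnorm X x"
    using T by (auto simp: bounded_operator_def)
  have "norm (f (T x)) \<le> (vnorm (dual Y) f * B) * vnorm X x" if x: "x \<in> vcarrier X" for x
  proof -
    have "norm (f (T x)) \<le> vnorm (dual Y) f * vnorm Y (T x)"
      using T x by (intro Y.norm_le_dual_norm [OF f]) (auto simp: bounded_operator_def)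
    also have "\<dots> \<le> vnorm (dual Y) f * (B * vnorm X x)"
      by (intro mult_left_mono B x Y.dual_norm_nonneg [OF f])
    finally show ?thesis by (simp add: mult.assoc)
  qed
  then show ?thesis
    using T by (intro dualI) (auto simp: pullback_def bounded_operator_def dualD [OF f])
qed

lemma bounded_operator_pullback:
  assumes T: "bounded_operator X Y T"
  shows "bounded_operator (dual Y) (dual X) (pullback X T)"
proof -
  obtain B where B: "0 \<le> B" "\<And>x. x \<in> vcarrier X \<Longrightarrow> vnorm Y (T x) \<le> B * vnorm X x"
    using T by (auto simp: bounded_operator_def)
  have "vnorm (dual X) (pullback X T f) \<le> B * vnorm (dual Y) f"
    if f: "f \<in> vcarrier (dual Y)" for f
  proof (rule X.dual_norm_le)
    fix x assume x: "x \<in> vcarrier X"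
    have "norm (f (T x)) \<le> vnorm (dual Y) f * vnorm Y (T x)"
      using T x by (intro Y.norm_le_dual_norm [OF f]) (auto simp: bounded_operator_def)
    also have "\<dots> \<le> vnorm (dual Y) f * (B * vnorm X x)"
      by (intro mult_left_mono B x Y.dual_norm_nonneg [OF f])
    finally show "norm (pullback X T f x) \<le> B * vnorm (dual Y) f * vnorm X x"
      using x by (simp add: pullback_def algebra_simps)
  qed (use B Y.dual_norm_nonneg [OF f] in simp)
  then show ?thesis
    using pullback_in_dual [OF T] B(1) by (auto simp: bounded_operator_def pullback_def)
qed

lemma continuous_map_weak_weak:
  assumes T: "bounded_operator X Y T"
  shows "continuous_map (weak_topology X) (weak_topology Y) T"
proof (rule Y.continuous_map_into_weak)
  fix f assume "f \<in> vcarrier (dual Y)"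
  from X.continuous_map_weak_functional [OF pullback_in_dual [OF T this]]
  show "continuous_map (weak_topology X) euclidean (\<lambda>x. f (T x))"
    by (rule continuous_map_eq) (simp add: pullback_def)
qed (use T in \<open>simp add: bounded_operator_def\<close>)

text \<open>The adjoint of \<open>T\<close> is bounded, so pulling back along it carries functionals on \<open>dual X\<close> to
  functionals on \<open>dual Y\<close>; hence it preserves weak \<open>p\<close>-summability.\<close>

lemma p_Vstar_set_image:
  assumes T: "bounded_operator X Y T" and K: "p_Vstar_set p X K"
  shows "p_Vstar_set p Y (T ` K)"
  unfolding p_Vstar_set_def
proof (intro conjI allI impI)
  have KX: "K \<subseteq> vcarrier X"
    using K by (simp add: p_Vstar_set_def)
  then show "T ` K \<subseteq> vcarrier Y"
    using T by (auto simp: bounded_operator_def)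
  obtain C where C: "\<And>x. x \<in> K \<Longrightarrow> vnorm X x \<le> C"
    using K by (auto simp: p_Vstar_set_def)
  obtain B where B: "0 \<le> B" "\<And>x. x \<in> vcarrier X \<Longrightarrow> vnorm Y (T x) \<le> B * vnorm X x"
    using T by (auto simp: bounded_operator_def)
  have "vnorm Y (T x) \<le> B * C" if "x \<in> K" for x
    using B C [OF that] KX that by (meson mult_left_mono order_trans subsetD)
  then show "\<exists>B. \<forall>y\<in>T ` K. vnorm Y y \<le> B" by blast
  fix f assume f: "weakly_p_summable p (dual Y) f"
  interpret D: normed_space_pair "dual Y" "dual X"
    by (intro normed_space_pair.intro X.normed_space_dual Y.normed_space_dual)
  have "weakly_p_summable p (dual X) (\<lambda>n. pullback X T (f n))"
    unfolding weakly_p_summable_def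
  proof (intro conjI allI ballI)
    show "pullback X T (f n) \<in> vcarrier (dual X)" for n
      using f pullback_in_dual [OF T] by (simp add: weakly_p_summable_def)
    fix \<phi> assume "\<phi> \<in> vcarrier (dual (dual X))"
    then have "pullback (dual Y) (pullback X T) \<phi> \<in> vcarrier (dual (dual Y))"
      by (rule D.pullback_in_dual [OF bounded_operator_pullback [OF T]])
    then have "summable (\<lambda>n. norm (pullback (dual Y) (pullback X T) \<phi> (f n)) powr p)"
      using f unfolding weakly_p_summable_def by blast
    then show "summable (\<lambda>n. norm (\<phi> (pullback X T (f n))) powr p)"
      using f by (simp add: weakly_p_summable_def pullback_def [of "dual Y"])
  qed
  then have "(\<lambda>n. SUP x\<in>K. ennreal (norm (pullback X T (f n) x))) \<longlonglongrightarrow> 0"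
    using K by (simp add: p_Vstar_set_def)
  also have "(\<lambda>n. SUP x\<in>K. ennreal (norm (pullback X T (f n) x)))
      = (\<lambda>n. SUP y\<in>T ` K. ennreal (norm (f n y)))"
    using KX by (auto simp: image_image pullback_def intro!: ext SUP_cong)
  finally show "(\<lambda>n. SUP y\<in>T ` K. ennreal (norm (f n y))) \<longlonglongrightarrow> 0" .
qed

end

section \<open>The geometry of \<open>\<ell>\<^sub>p\<close>-sums\<close>

text \<open>The graph of \<open>b \<mapsto> b powr p\<close> lies above its tangent at \<open>a\<close>; this is Young's
  inequality for the exponents \<open>p / (p - 1)\<close> and \<open>p\<close>.\<close>

lemma powr_tangent:
  fixes a b p :: real
  assumes p: "1 \<le> p" and "0 \<le> a" "0 \<le> b"
  shows "p * (a powr (p - 1) * b) \<le> (p - 1) * a powr p + b powr p"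
proof (cases "p = 1")
  case True
  then show ?thesis using assms by simp
next
  case False
  then have p1: "1 < p" using p by simp
  have "a powr (p - 1) * b \<le> (a powr (p - 1)) powr (p / (p - 1)) / (p / (p - 1)) + b powr p / p"
    using p1 assms by (intro Youngs_inequality) (auto simp: field_simps)
  also have "\<dots> = ((p - 1) * a powr p + b powr p) / p"
    using p1 by (simp add: powr_powr add_divide_distrib mult.commute)
  finally show ?thesis
    using p1 by (simp add: pos_le_divide_eq mult.commute)
qed

lemma powr_times_self: "(0::real) \<le> a \<Longrightarrow> a powr (p - 1) * a = a powr p"
  by (cases "a = 0") (simp_all add: powr_diff)

text \<open>This is the tangent inequality at \<open>s * a + t * b\<close>, averaged over \<open>a\<close> and \<open>b\<close>.\<close>

lemma powr_convex_combination:
  fixes a b p s t :: real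
  assumes p: "1 \<le> p" and "0 \<le> a" "0 \<le> b" "0 \<le> s" "0 \<le> t" "s + t = 1"
  shows "(s * a + t * b) powr p \<le> s * a powr p + t * b powr p"
proof -
  define c where "c = s * a + t * b"
  have c: "0 \<le> c" using assms by (simp add: c_def)
  have "p * c powr p = p * (c powr (p - 1) * (s * a + t * b))"
    using powr_times_self [OF c] by (simp add: c_def)
  also have "\<dots> = s * (p * (c powr (p - 1) * a)) + t * (p * (c powr (p - 1) * b))"
    by (simp add: algebra_simps)
  also have "\<dots> \<le> s * ((p - 1) * c powr p + a powr p) + t * ((p - 1) * c powr p + b powr p)"
    using assms c by (intro add_mono mult_left_mono powr_tangent) auto
  also have "\<dots> = (s + t) * ((p - 1) * c powr p) + (s * a powr p + t * b powr p)"
    by (simp add: algebra_simps)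
  finally show ?thesis
    using assms by (simp add: c_def algebra_simps)
qed

text \<open>Since \<open>(a\<^sub>n + b\<^sub>n) / (A + B)\<close> is a convex combination of \<open>a\<^sub>n / A\<close> and \<open>b\<^sub>n / B\<close>, this is
  the convexity of the unit ball. Strictly positive bounds avoid a division by zero; they are
  approximated by \<open>\<parallel>a\<parallel> + e / 2\<close> and \<open>\<parallel>b\<parallel> + e / 2\<close> in the inequality between norms.\<close>

lemma Minkowski_aux:
  fixes a b :: "nat \<Rightarrow> real"
  assumes p: "1 \<le> p" and ab: "\<And>n. 0 \<le> a n" "\<And>n. 0 \<le> b n"
    and AB: "0 < A" "0 < B"
    and a: "summable (\<lambda>n. a n powr p)" "(\<Sum>n. a n powr p) \<le> A powr p"
    and b: "summable (\<lambda>n. b n powr p)" "(\<Sum>n. b n powr p) \<le> B powr p"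
  shows "summable (\<lambda>n. (a n + b n) powr p)" "(\<Sum>n. (a n + b n) powr p) \<le> (A + B) powr p"
proof -
  define s t where "s = A / (A + B)" and "t = B / (A + B)"
  have st: "0 \<le> s" "0 \<le> t" "s + t = 1"
    using AB by (auto simp: s_def t_def simp flip: add_divide_distrib)
  define h where
    "h n = (A + B) powr p * (s / A powr p * a n powr p + t / B powr p * b n powr p)" for n
  have le: "(a n + b n) powr p \<le> h n" for n
  proof -
    have "a n + b n = (A + B) * (s * (a n / A) + t * (b n / B))"
      using AB by (simp add: s_def t_def distrib_left)
    then have "(a n + b n) powr p = (A + B) powr p * (s * (a n / A) + t * (b n / B)) powr p"
      using AB ab st by (simp add: powr_mult)
    also have "\<dots> \<le> (A + B) powr p * (s * (a n / A) powr p + t * (b n / B) powr p)"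
      using AB ab st p by (intro mult_left_mono powr_convex_combination) auto
    also have "\<dots> = h n"
      using AB ab by (simp add: h_def powr_divide)
    finally show ?thesis .
  qed
  have sums: "h sums ((A + B) powr p *
      (s / A powr p * (\<Sum>n. a n powr p) + t / B powr p * (\<Sum>n. b n powr p)))"
    unfolding h_def by (intro sums_mult sums_add summable_sums a b)
  then show summable: "summable (\<lambda>n. (a n + b n) powr p)"
    by (intro summable_comparison_test' [OF sums_summable [OF sums], of 0]) (use le in simp)
  have "(\<Sum>n. (a n + b n) powr p) \<le> (\<Sum>n. h n)"
    by (intro suminf_le le summable sums_summable [OF sums])
  also have "\<dots> \<le> (A + B) powr p * (s / A powr p * A powr p + t / B powr p * B powr p)"
    unfolding sums_unique [OF sums, symmetric]
    using a b AB st by (intro mult_left_mono add_mono) auto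
  also have "\<dots> = (A + B) powr p"
    using AB st by simp
  finally show "(\<Sum>n. (a n + b n) powr p) \<le> (A + B) powr p" .
qed

lemma Minkowski_suminf:
  fixes a b :: "nat \<Rightarrow> real"
  assumes p: "1 \<le> p" and ab: "\<And>n. 0 \<le> a n" "\<And>n. 0 \<le> b n"
    and a: "summable (\<lambda>n. a n powr p)" and b: "summable (\<lambda>n. b n powr p)"
  shows "summable (\<lambda>n. (a n + b n) powr p)" (is ?S)
    and "(\<Sum>n. (a n + b n) powr p) powr (1 / p) \<le>
      (\<Sum>n. a n powr p) powr (1 / p) + (\<Sum>n. b n powr p) powr (1 / p)"
proof -
  define A B where "A = (\<Sum>n. a n powr p) powr (1 / p)" and "B = (\<Sum>n. b n powr p) powr (1 / p)"
  have *: "?S \<and> (\<Sum>n. (a n + b n) powr p) powr (1 / p) \<le> A + B + e" if "0 < e" for e :: real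
  proof -
    have nonneg: "0 \<le> A" "0 \<le> B"
      by (simp_all add: A_def B_def)
    have "(\<Sum>n. a n powr p) = A powr p" "(\<Sum>n. b n powr p) = B powr p"
      using p a b by (simp_all add: A_def B_def powr_powr suminf_nonneg)
    then have "(\<Sum>n. a n powr p) \<le> (A + e / 2) powr p" "(\<Sum>n. b n powr p) \<le> (B + e / 2) powr p"
      using p that nonneg by (auto intro!: powr_mono2)
    then have "?S" and le: "(\<Sum>n. (a n + b n) powr p) \<le> ((A + e / 2) + (B + e / 2)) powr p"
      using Minkowski_aux [OF p ab, of "A + e / 2" "B + e / 2"] a b that nonneg by auto
    moreover have "(\<Sum>n. (a n + b n) powr p) powr (1 / p) \<le> (((A + e / 2) + (B + e / 2)) powr p) powr (1 / p)"
      using p le \<open>?S\<close> by (intro powr_mono2) (auto simp: suminf_nonneg)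
    ultimately show ?thesis
      using p that nonneg by (simp add: powr_powr algebra_simps)
  qed
  show ?S using * [of 1] by simp
  show "(\<Sum>n. (a n + b n) powr p) powr (1 / p) \<le>
      (\<Sum>n. a n powr p) powr (1 / p) + (\<Sum>n. b n powr p) powr (1 / p)"
    unfolding A_def [symmetric] B_def [symmetric]
    by (rule field_le_epsilon) (rule conjunct2 [OF *])
qed

text \<open>Multiplication by a scalar sequence, coordinate by coordinate. With the indicator of a set
  this is the projection of an \<open>\<ell>\<^sub>p\<close>-sum onto a set of coordinates, and linearity in the
  sequence makes linear combinations of such projections accessible.\<close>

definition multiplier ::
    "(nat \<Rightarrow> ('k::rc_field, 'a) nspace) \<Rightarrow> (nat \<Rightarrow> 'k) \<Rightarrow> (nat \<Rightarrow> 'a) \<Rightarrow> nat \<Rightarrow> 'a" where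
  "multiplier X d x n = vscale (X n) (d n) (x n)"

definition summand_embed ::
    "(nat \<Rightarrow> ('k::rc_field, 'a) nspace) \<Rightarrow> nat \<Rightarrow> 'a \<Rightarrow> nat \<Rightarrow> 'a" where
  "summand_embed X n y m = (if m = n then y else vzero (X m))"

locale normed_space_sequence =
  fixes X :: "nat \<Rightarrow> ('k::rc_field, 'a) nspace" and p :: real
  assumes normed: "normed_space (X n)" and p: "1 \<le> p"
begin

abbreviation Y where "Y \<equiv> lp_sum p X"

sublocale X: normed_space "X n" for n
  by (rule normed)

lemma lp_simps [simp]:
  "vzero Y = (\<lambda>n. vzero (X n))"
  "vadd Y = (\<lambda>x y n. vadd (X n) (x n) (y n))"
  "vscale Y = (\<lambda>c x n. vscale (X n) c (x n))"
  by (simp_all add: lp_sum_def)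

lemma in_carrier:
  "x \<in> vcarrier Y \<longleftrightarrow> (\<forall>n. x n \<in> vcarrier (X n)) \<and> summable (\<lambda>n. vnorm (X n) (x n) powr p)"
  by (simp add: lp_sum_def)

lemma coordinate_in_carrier: "x \<in> vcarrier Y \<Longrightarrow> x n \<in> vcarrier (X n)"
  by (simp add: in_carrier)

lemma norm_eq: "vnorm Y x = (\<Sum>n. vnorm (X n) (x n) powr p) powr (1 / p)"
  by (simp add: lp_sum_def)

lemma norm_powr:
  assumes "x \<in> vcarrier Y"
  shows "vnorm Y x powr p = (\<Sum>n. vnorm (X n) (x n) powr p)"
  using p assms by (simp add: norm_eq powr_powr suminf_nonneg in_carrier)

lemma solid:
  assumes x: "x \<in> vcarrier Y" and z: "\<And>n. z n \<in> vcarrier (X n)"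
    and le: "\<And>n. vnorm (X n) (z n) \<le> vnorm (X n) (x n)"
  shows "z \<in> vcarrier Y" "vnorm Y z \<le> vnorm Y x"
proof -
  have powr_le: "vnorm (X n) (z n) powr p \<le> vnorm (X n) (x n) powr p" for n
    using le z p by (intro powr_mono2) (auto simp: X.norm_nonneg)
  have x_sum: "summable (\<lambda>n. vnorm (X n) (x n) powr p)"
    using x by (simp add: in_carrier)
  have "summable (\<lambda>n. vnorm (X n) (z n) powr p)"
    by (rule summable_comparison_test' [OF x_sum, of 0]) (use powr_le in simp)
  then show "z \<in> vcarrier Y" "vnorm Y z \<le> vnorm Y x"
    using z p x_sum powr_le
    by (simp_all add: in_carrier norm_eq powr_mono2 suminf_le suminf_nonneg)
qed

lemma coordinate_norm_le:
  assumes "x \<in> vcarrier Y"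
  shows "vnorm (X n) (x n) \<le> vnorm Y x"
proof -
  have "vnorm (X n) (x n) powr p \<le> vnorm Y x powr p"
    unfolding norm_powr [OF assms]
    using sum_le_suminf [of "\<lambda>n. vnorm (X n) (x n) powr p" "{n}"] assms by (simp add: in_carrier)
  moreover have "0 \<le> vnorm Y x"
    by (simp add: norm_eq)
  ultimately show ?thesis
    using p powr_less_mono2 [of p "vnorm Y x" "vnorm (X n) (x n)"] by (meson not_le less_le_trans zero_less_one)
qed

lemma normed_space_lp_sum: "normed_space Y"
proof
  have "(\<lambda>n. vnorm (X n) (vzero (X n)) powr p) = (\<lambda>n. 0)"
    using p by (simp add: X.norm_zero_vector)
  then show zero: "vzero Y \<in> vcarrier Y"
    by (simp add: in_carrier)
  fix x c d assume x: "x \<in> vcarrier Y"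
  note xn = coordinate_in_carrier [OF x]
  have powr_scale: "vnorm (X n) (vscale (X n) c (x n)) powr p
      = norm c powr p * vnorm (X n) (x n) powr p" for n
    by (simp add: X.norm_scale xn powr_mult X.norm_nonneg)
  have x_sum: "summable (\<lambda>n. vnorm (X n) (x n) powr p)"
    using x by (simp add: in_carrier)
  show scale_closed: "vscale Y c x \<in> vcarrier Y"
    using xn x_sum by (auto simp: in_carrier powr_scale intro!: summable_mult)
  show "0 \<le> vnorm Y x"
    by (simp add: norm_eq)
  show "vnorm Y x = 0 \<longleftrightarrow> x = vzero Y"
  proof
    assume "vnorm Y x = 0"
    then have "vnorm (X n) (x n) = 0" for n
      using coordinate_norm_le [OF x, of n] X.norm_nonneg [OF xn, of n] by simp
    then show "x = vzero Y"
      by (auto simp: X.norm_eq_zero xn)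
  next
    assume "x = vzero Y"
    then show "vnorm Y x = 0"
      using p by (simp add: norm_eq X.norm_zero_vector)
  qed
  show "vnorm Y (vscale Y c x) = norm c * vnorm Y x"
    using p x_sum
    by (simp add: norm_eq powr_scale suminf_mult powr_mult powr_powr suminf_nonneg)
  show "\<exists>y\<in>vcarrier Y. vadd Y x y = vzero Y"
  proof
    show "vscale Y (- 1) x \<in> vcarrier Y"
      by (rule solid [OF x]) (simp_all add: xn X.norm_scale)
  qed (simp add: X.add_uminus xn)
  fix y assume y: "y \<in> vcarrier Y"
  note yn = coordinate_in_carrier [OF y]
  have y_sum: "summable (\<lambda>n. vnorm (X n) (y n) powr p)"
    using y by (simp add: in_carrier)
  note Minkowski = Minkowski_suminf [OF p X.norm_nonneg [OF xn] X.norm_nonneg [OF yn] x_sum y_sum]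
  have le: "vnorm (X n) (vadd (X n) (x n) (y n)) powr p
      \<le> (vnorm (X n) (x n) + vnorm (X n) (y n)) powr p" for n
    using p by (intro powr_mono2 X.norm_triangle xn yn X.norm_nonneg X.add_closed) auto
  have sum: "summable (\<lambda>n. vnorm (X n) (vadd (X n) (x n) (y n)) powr p)"
    by (rule summable_comparison_test' [OF Minkowski(1), of 0]) (use le in simp)
  then show "vadd Y x y \<in> vcarrier Y"
    using xn yn by (simp add: in_carrier)
  have "vnorm Y (vadd Y x y) \<le> (\<Sum>n. (vnorm (X n) (x n) + vnorm (X n) (y n)) powr p) powr (1 / p)"
    unfolding norm_eq lp_simps
    using p by (intro powr_mono2 suminf_le le sum Minkowski suminf_nonneg) auto
  also have "\<dots> \<le> vnorm Y x + vnorm Y y"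
    using Minkowski(2) by (simp add: norm_eq)
  finally show "vnorm Y (vadd Y x y) \<le> vnorm Y x + vnorm Y y" .
  show "vadd Y x (vzero Y) = x"
    by (simp add: xn X.add_zero)
  show "vscale Y (c + d) x = vadd Y (vscale Y c x) (vscale Y d x)"
    by (simp add: xn X.scale_add_left)
  show "vscale Y c (vscale Y d x) = vscale Y (c * d) x"
    by (simp add: xn X.scale_scale)
  show "vscale Y 1 x = x"
    by (simp add: xn X.scale_one)
  show "vadd Y x y = vadd Y y x"
    by (auto simp: xn yn X.add_commute)
  show "vscale Y c (vadd Y x y) = vadd Y (vscale Y c x) (vscale Y c y)"
    by (auto simp: xn yn X.scale_add_right)
  fix z assume "z \<in> vcarrier Y"
  note zn = coordinate_in_carrier [OF this]
  show "vadd Y (vadd Y x y) z = vadd Y x (vadd Y y z)"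
    by (auto simp: xn yn zn X.add_assoc)
qed

sublocale Y: normed_space Y
  by (rule normed_space_lp_sum)

sublocale YX: normed_space_pair Y "X n" for n
  by unfold_locales

sublocale XY: normed_space_pair "X n" Y for n
  by unfold_locales

sublocale YY: normed_space_pair Y Y
  by unfold_locales

lemma bounded_operator_coordinate: "bounded_operator Y (X n) (\<lambda>x. x n)"
  unfolding bounded_operator_def
proof (intro conjI exI [of _ 1])
  show "\<forall>x\<in>vcarrier Y. x n \<in> vcarrier (X n)"
    by (simp add: in_carrier)
qed (simp_all add: coordinate_norm_le)

lemma multiplier_closed:
  assumes "\<And>n. norm (d n) \<le> 1" and x: "x \<in> vcarrier Y"
  shows "multiplier X d x \<in> vcarrier Y" "vnorm Y (multiplier X d x) \<le> vnorm Y x"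
proof -
  note xn = coordinate_in_carrier [OF x]
  have 1: "multiplier X d x n \<in> vcarrier (X n)" for n
    by (simp add: multiplier_def xn)
  have 2: "vnorm (X n) (multiplier X d x n) \<le> vnorm (X n) (x n)" for n
    using assms(1) [of n]
    by (simp add: multiplier_def xn X.norm_scale X.norm_nonneg mult_left_le_one_le)
  show "multiplier X d x \<in> vcarrier Y" "vnorm Y (multiplier X d x) \<le> vnorm Y x"
    by (rule solid [OF x 1 2])+
qed

lemma bounded_operator_multiplier:
  assumes "\<And>n. norm (d n) \<le> 1"
  shows "bounded_operator Y Y (multiplier X d)"
  unfolding bounded_operator_def
proof (intro conjI ballI allI exI [of _ 1])
  fix x assume x: "x \<in> vcarrier Y"
  note xn = coordinate_in_carrier [OF x]
  show "multiplier X d x \<in> vcarrier Y" "vnorm Y (multiplier X d x) \<le> 1 * vnorm Y x"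
    using multiplier_closed [OF assms x] by simp_all
  show "multiplier X d (vscale Y c x) = vscale Y c (multiplier X d x)" for c
    by (simp add: fun_eq_iff multiplier_def xn X.scale_scale mult.commute)
  fix y assume y: "y \<in> vcarrier Y"
  show "multiplier X d (vadd Y x y) = vadd Y (multiplier X d x) (multiplier X d y)"
    by (simp add: fun_eq_iff multiplier_def xn coordinate_in_carrier [OF y] X.scale_add_right)
qed simp

lemma norm_embed:
  assumes "y \<in> vcarrier (X n)"
  shows "summand_embed X n y \<in> vcarrier Y" "vnorm Y (summand_embed X n y) = vnorm (X n) y"
proof -
  have "(\<lambda>m. vnorm (X m) (summand_embed X n y m) powr p) = (\<lambda>m. if m = n then vnorm (X n) y powr p else 0)"
    using p by (auto simp: summand_embed_def X.norm_zero_vector)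
  then have "(\<lambda>m. vnorm (X m) (summand_embed X n y m) powr p) sums (vnorm (X n) y powr p)"
    using sums_single [of n "\<lambda>_. vnorm (X n) y powr p"] by simp
  then show "summand_embed X n y \<in> vcarrier Y" "vnorm Y (summand_embed X n y) = vnorm (X n) y"
    using assms p by (auto simp: in_carrier norm_eq sums_iff powr_powr X.norm_nonneg)
      (auto simp: summand_embed_def)
qed

lemma bounded_operator_embed: "bounded_operator (X n) Y (summand_embed X n)"
  unfolding bounded_operator_def
  by (auto intro!: exI [of _ 1] simp: norm_embed) (auto simp: summand_embed_def X.add_zero)

lemma functional_block:
  assumes f: "f \<in> vcarrier (dual Y)" and x: "x \<in> vcarrier Y" and A: "finite A"
  shows "f (multiplier X (\<lambda>n. of_bool (n \<in> A)) x) = (\<Sum>n\<in>A. f (summand_embed X n (x n)))"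
  using A
proof induction
  case empty
  have "multiplier X (\<lambda>n. of_bool (n \<in> {})) x = vzero Y"
    using coordinate_in_carrier [OF x] by (auto simp: multiplier_def)
  then show ?case
    using Y.dual_zero [OF f] by simp
next
  case (insert m A)
  have "multiplier X (\<lambda>n. of_bool (n \<in> insert m A)) x
      = vadd Y (summand_embed X m (x m)) (multiplier X (\<lambda>n. of_bool (n \<in> A)) x)"
    using insert.hyps coordinate_in_carrier [OF x]
    by (auto simp: multiplier_def summand_embed_def X.add_zero X.scale_one X.add_commute)
  then show ?case
    using insert dualD(2) [OF f norm_embed(1) multiplier_closed(1) [OF _ x]]
      coordinate_in_carrier [OF x] by simp
qed

text \<open>Here \<open>p < \<infinity>\<close> enters: the tails of an element of an \<open>\<ell>\<^sub>p\<close>-sum tend to \<open>0\<close> in norm. Thus a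
  functional on the sum is determined by its restrictions to the summands.\<close>

lemma functional_sums:
  assumes f: "f \<in> vcarrier (dual Y)" and x: "x \<in> vcarrier Y"
  shows "(\<lambda>n. f (summand_embed X n (x n))) sums f x"
proof -
  have xn: "x n \<in> vcarrier (X n)" for n
    using x by (rule coordinate_in_carrier)
  have x_sum: "summable (\<lambda>n. vnorm (X n) (x n) powr p)"
    using x by (simp add: in_carrier)
  define tail where "tail N = multiplier X (\<lambda>n. of_bool (N \<le> n)) x" for N
  have tail: "tail N \<in> vcarrier Y" for N
    unfolding tail_def using x by (intro multiplier_closed) auto
  have split: "f x = (\<Sum>n<N. f (summand_embed X n (x n))) + f (tail N)" for N
  proof -
    have "x = vadd Y (multiplier X (\<lambda>n. of_bool (n \<in> {..<N})) x) (tail N)"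
      using xn by (auto simp: multiplier_def tail_def X.add_zero X.scale_one X.add_commute)
    then have "f x = f (vadd Y (multiplier X (\<lambda>n. of_bool (n \<in> {..<N})) x) (tail N))"
      by (rule arg_cong)
    also have "\<dots> = f (multiplier X (\<lambda>n. of_bool (n \<in> {..<N})) x) + f (tail N)"
      using dualD(2) [OF f multiplier_closed(1) [OF _ x] tail] by simp
    finally show ?thesis
      by (simp only: functional_block [OF f x finite_lessThan])
  qed
  have "vnorm Y (tail N) = (\<Sum>n. vnorm (X (n + N)) (x (n + N)) powr p) powr (1 / p)" for N
  proof -
    have "(\<lambda>n. vnorm (X n) (tail N n) powr p) =
        (\<lambda>n. if n < N then 0 else vnorm (X n) (x n) powr p)"
      using p xn by (auto simp: tail_def multiplier_def X.scale_one X.norm_zero_vector)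
    moreover from this have "summable (\<lambda>n. if n < N then 0 else vnorm (X n) (x n) powr p)"
      using tail [of N] by (simp add: in_carrier)
    from suminf_split_initial_segment [OF this, of N]
    have "(\<Sum>n. if n < N then 0 else vnorm (X n) (x n) powr p)
        = (\<Sum>n. vnorm (X (n + N)) (x (n + N)) powr p)"
      by simp
    ultimately show ?thesis
      by (simp add: norm_eq)
  qed
  moreover have "(\<lambda>N. (\<Sum>n. vnorm (X (n + N)) (x (n + N)) powr p) powr (1 / p)) \<longlonglongrightarrow> 0 powr (1 / p)"
    using p suminf_exist_split2 [OF x_sum]
    by (intro tendsto_powr2) (auto intro!: always_eventually suminf_nonneg
        simp: summable_iff_shift [where f = "\<lambda>n. vnorm (X n) (x n) powr p"] x_sum)
  ultimately have "(\<lambda>N. vnorm Y (tail N)) \<longlonglongrightarrow> 0"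
    using p by simp
  then have "(\<lambda>N. vnorm (dual Y) f * vnorm Y (tail N)) \<longlonglongrightarrow> 0"
    by (rule tendsto_mult_right_zero)
  then have "(\<lambda>N. f (tail N)) \<longlonglongrightarrow> 0"
    by (rule Lim_null_comparison [rotated]) (simp add: Y.norm_le_dual_norm f tail)
  then have "(\<lambda>N. f x - f (tail N)) \<longlonglongrightarrow> f x - 0"
    by (intro tendsto_intros)
  moreover have "f x - f (tail N) = (\<Sum>n<N. f (summand_embed X n (x n)))" for N
    using split [of N] by simp
  ultimately show ?thesis
    by (simp add: sums_def)
qed

end

section \<open>Uniformly small tails\<close>

context normed_space_sequence
begin

text \<open>Gliding hump: cutting a functional along disjoint blocks gives a sequence that is
  weakly summable, because a combination of the pieces with coefficients in the unit ball is the
  functional composed with a multiplier of norm at most \<open>1\<close>.\<close>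

lemma weakly_p_summable_blocks:
  assumes f: "f \<in> vcarrier (dual Y)" and A: "disjoint_family A"
  shows "weakly_p_summable p (dual Y)
    (\<lambda>j. pullback Y (multiplier X (\<lambda>n. of_bool (n \<in> A j))) f)"
proof (rule Y.weakly_p_summable_dualI [OF _ Y.dual_norm_nonneg [OF f] p])
  show "pullback Y (multiplier X (\<lambda>n. of_bool (n \<in> A j))) f \<in> vcarrier (dual Y)" for j
    by (intro YY.pullback_in_dual bounded_operator_multiplier f) simp
  fix c :: "nat \<Rightarrow> 'k" and J :: nat and x
  assume c: "\<And>j. norm (c j) \<le> 1" and x: "x \<in> vcarrier Y"
  note xn = coordinate_in_carrier [OF x]
  define d where "d J n = (\<Sum>j<J. c j * of_bool (n \<in> A j))" for J n
  have d: "norm (d J n) \<le> 1" for J n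
  proof (cases "\<exists>i. n \<in> A i")
    case True
    then obtain i where i: "n \<in> A i" by blast
    then have "n \<in> A j \<longleftrightarrow> j = i" for j
      using A by (auto simp: disjoint_family_on_def)
    then have "d J n = (\<Sum>j<J. if j = i then c j else 0)"
      by (auto simp: d_def intro!: sum.cong)
    also have "\<dots> = (if i < J then c i else 0)"
      by simp
    finally show ?thesis
      using c by simp
  next
    case False
    then show ?thesis by (simp add: d_def)
  qed
  have "(\<Sum>j<J. c j * f (multiplier X (\<lambda>n. of_bool (n \<in> A j)) x)) = f (multiplier X (d J) x)"
  proof (induction J)
    case 0
    have "multiplier X (d 0) x = vzero Y"
      using xn by (auto simp: multiplier_def d_def)
    then show ?case
      using Y.dual_zero [OF f] by simp
  next
    case (Suc J)
    let ?P = "multiplier X (\<lambda>n. of_bool (n \<in> A J)) x"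
    have P: "?P \<in> vcarrier Y"
      by (rule multiplier_closed(1) [OF _ x]) simp
    have "multiplier X (d (Suc J)) x = vadd Y (multiplier X (d J) x) (vscale Y (c J) ?P)"
      using xn by (simp add: fun_eq_iff multiplier_def d_def X.scale_add_left X.scale_scale)
    then have "f (multiplier X (d (Suc J)) x)
        = f (vadd Y (multiplier X (d J) x) (vscale Y (c J) ?P))"
      by (rule arg_cong)
    also have "\<dots> = f (multiplier X (d J) x) + c J * f ?P"
      using dualD(2) [OF f multiplier_closed(1) [OF d x] Y.scale_closed [OF P]] dualD(3) [OF f P]
      by simp
    finally show ?case
      using Suc by simp
  qed
  then have "norm (\<Sum>j<J. c j * pullback Y (multiplier X (\<lambda>n. of_bool (n \<in> A j))) f x)
      = norm (f (multiplier X (d J) x))"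
    using x by (simp add: pullback_def)
  also have "\<dots> \<le> vnorm (dual Y) f * vnorm Y (multiplier X (d J) x)"
    by (rule Y.norm_le_dual_norm [OF f multiplier_closed(1) [OF d x]])
  also have "\<dots> \<le> vnorm (dual Y) f * vnorm Y x"
    by (rule mult_left_mono [OF multiplier_closed(2) [OF d x] Y.dual_norm_nonneg [OF f]])
  finally show "norm (\<Sum>j<J. c j * pullback Y (multiplier X (\<lambda>n. of_bool (n \<in> A j))) f x)
      \<le> vnorm (dual Y) f * vnorm Y x" .
qed

text \<open>If the tails were not uniformly small on \<open>K\<close>, there would be disjoint blocks whose pieces of
  \<open>f\<close> exceed \<open>e\<close> somewhere on \<open>K\<close>, although these pieces are weakly \<open>p\<close>-summable.\<close>

lemma uniform_tails:
  assumes K: "p_Vstar_set p Y K" and f: "f \<in> vcarrier (dual Y)" and e: "0 < e"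
  obtains N where "\<And>M L x. N \<le> M \<Longrightarrow> x \<in> K \<Longrightarrow> norm (\<Sum>n=M..<L. f (summand_embed X n (x n))) \<le> e"
proof (rule ccontr)
  assume "\<not> thesis"
  then have "\<forall>N. \<exists>M L x. N \<le> M \<and> x \<in> K \<and> e < norm (\<Sum>n=M..<L. f (summand_embed X n (x n)))"
    using that by (meson not_le)
  then obtain M L x where LM: "\<And>N. N \<le> M N" and x: "\<And>N. x N \<in> K"
    and large: "\<And>N. e < norm (\<Sum>n=M N..<L N. f (summand_embed X n (x N n)))"
    by metis
  have KY: "K \<subseteq> vcarrier Y"
    using K by (simp add: p_Vstar_set_def)
  have less: "M N < L N" for N
    using large [of N] e by (cases "M N < L N") auto
  \<comment> \<open>Each block is chosen beyond the end of the previous one.\<close>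
  define start where "start j = (L ^^ j) 0" for j
  have start_Suc: "start (Suc j) = L (start j)" for j
    by (simp add: start_def)
  have "mono start"
    using le_less_trans [OF LM less] by (intro incseq_SucI) (simp add: start_Suc less_imp_le)
  define A where "A j = {M (start j)..<L (start j)}" for j
  have "A i \<inter> A j = {}" if "i < j" for i j
  proof -
    have "L (start i) \<le> M (start j)"
      using monoD [OF \<open>mono start\<close>, of "Suc i" j] that LM [of "start j"] by (simp add: start_Suc)
    then show ?thesis by (auto simp: A_def)
  qed
  then have A: "disjoint_family A"
    unfolding disjoint_family_on_def by (metis Int_commute linorder_neqE_nat)
  let ?g = "\<lambda>j. pullback Y (multiplier X (\<lambda>n. of_bool (n \<in> A j))) f"
  have "(\<lambda>j. SUP x\<in>K. ennreal (norm (?g j x))) \<longlonglongrightarrow> 0"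
    using K weakly_p_summable_blocks [OF f A] by (simp add: p_Vstar_set_def)
  then have "eventually (\<lambda>j. (SUP x\<in>K. ennreal (norm (?g j x))) < ennreal e) sequentially"
    by (rule order_tendstoD(2)) (use e in simp)
  then obtain j where j: "(SUP x\<in>K. ennreal (norm (?g j x))) < ennreal e"
    by (auto simp: eventually_sequentially)
  let ?x = "x (start j)"
  have xY: "?x \<in> vcarrier Y"
    using x KY by blast
  have "?g j ?x = (\<Sum>n=M (start j)..<L (start j). f (summand_embed X n (?x n)))"
    using functional_block [OF f xY, of "A j"] xY by (simp add: pullback_def A_def)
  then have "ennreal e < ennreal (norm (?g j ?x))"
    using large [of "start j"] e by (simp add: ennreal_less_iff)
  also have "\<dots> \<le> (SUP x\<in>K. ennreal (norm (?g j x)))"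
    by (rule SUP_upper) (rule x)
  finally show False
    using j by simp
qed

section \<open>Coordinatewise limits\<close>

abbreviation coordinatewise where
  "coordinatewise \<equiv> product_topology (\<lambda>n. weak_topology (X n)) UNIV"

lemma topspace_coordinatewise: "x \<in> topspace coordinatewise \<longleftrightarrow> (\<forall>n. x n \<in> vcarrier (X n))"
  by (simp add: PiE_iff)

lemma continuous_map_coordinate_functional:
  assumes "g \<in> vcarrier (dual (X n))"
  shows "continuous_map coordinatewise euclidean (\<lambda>x. g (x n))"
proof -
  have "continuous_map coordinatewise (weak_topology (X n)) (\<lambda>x. x n)"
    by (rule continuous_map_product_projection) simp
  from continuous_map_compose [OF this X.continuous_map_weak_functional [OF assms]]
  show ?thesis
    by (simp add: o_def)
qed

lemma continuous_map_block:
  assumes f: "f \<in> vcarrier (dual Y)" and A: "finite A"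
  shows "continuous_map coordinatewise euclidean (\<lambda>x. \<Sum>n\<in>A. f (summand_embed X n (x n)))"
proof (rule continuous_map_sum [OF A])
  fix n
  have "continuous_map coordinatewise euclidean (\<lambda>x. pullback (X n) (summand_embed X n) f (x n))"
    by (intro continuous_map_coordinate_functional XY.pullback_in_dual bounded_operator_embed f)
  then show "continuous_map coordinatewise euclidean (\<lambda>x. f (summand_embed X n (x n)))"
    by (rule continuous_map_eq) (simp add: pullback_def topspace_coordinatewise
        del: topspace_product_topology)
qed

text \<open>The norm of an \<open>\<ell>\<^sub>p\<close>-sum is lower semicontinuous for coordinatewise weak convergence:
  with functionals \<open>h\<^sub>n\<close> norming \<open>z\<^sub>n\<close>, the functional
  \<open>x \<mapsto> \<Sum>n<N. \<parallel>z\<^sub>n\<parallel> powr (p - 1) * h\<^sub>n (x\<^sub>n)\<close> takes the value \<open>s = \<Sum>n<N. \<parallel>z\<^sub>n\<parallel> powr p\<close> at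
  \<open>z\<close> and is at most \<open>((p - 1) * s + B powr p) / p\<close> on the ball of radius \<open>B\<close>.\<close>

lemma coordinatewise_closure_subset:
  assumes KY: "K \<subseteq> vcarrier Y" and B: "\<And>x. x \<in> K \<Longrightarrow> vnorm Y x \<le> B"
  shows "coordinatewise closure_of K \<subseteq> vcarrier Y"
proof
  fix z assume z: "z \<in> coordinatewise closure_of K"
  then have "z \<in> topspace coordinatewise"
    by (meson closure_of_subset_topspace subsetD)
  then have zn: "z n \<in> vcarrier (X n)" for n
    by (simp only: topspace_coordinatewise)
  have "\<exists>h. h \<in> vcarrier (dual (X n)) \<and> (\<forall>x\<in>vcarrier (X n). norm (h x) \<le> vnorm (X n) x) \<and>
      h (z n) = of_real (vnorm (X n) (z n))" for n
    using X.exists_norming_functional [OF zn [of n]] by metis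
  then obtain h where h: "\<And>n. h n \<in> vcarrier (dual (X n))"
    "\<And>n x. x \<in> vcarrier (X n) \<Longrightarrow> norm (h n x) \<le> vnorm (X n) x"
    "\<And>n. h n (z n) = of_real (vnorm (X n) (z n))"
    by metis
  have "(\<Sum>n<N. vnorm (X n) (z n) powr p) \<le> B powr p" for N
  proof -
    define s where "s = (\<Sum>n<N. vnorm (X n) (z n) powr p)"
    define c where "c n = vnorm (X n) (z n) powr (p - 1)" for n
    define G where "G x = (\<Sum>n<N. of_real (c n) * h n (x n))" for x
    have "(\<lambda>y. of_real (c n) * h n y) \<in> vcarrier (dual (X n))" for n
      using normed_space.scale_closed [OF X.normed_space_dual h(1)] by simp
    then have G: "continuous_map coordinatewise euclidean G"
      unfolding G_def by (intro continuous_map_sum continuous_map_coordinate_functional) auto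
    have "norm (G z) \<le> ((p - 1) * s + B powr p) / p"
    proof (rule norm_le_on_closure [OF G _ z])
      fix x assume xK: "x \<in> K"
      then have x: "x \<in> vcarrier Y"
        using KY by blast
      note xn = coordinate_in_carrier [OF x]
      have "p * norm (G x) \<le> p * (\<Sum>n<N. c n * vnorm (X n) (x n))"
        unfolding G_def using p h(2) [OF xn]
        by (intro mult_left_mono order_trans [OF norm_sum] sum_mono)
          (auto simp: norm_mult c_def intro!: mult_left_mono)
      also have "\<dots> = (\<Sum>n<N. p * (c n * vnorm (X n) (x n)))"
        by (simp add: sum_distrib_left)
      also have "\<dots> \<le> (\<Sum>n<N. (p - 1) * vnorm (X n) (z n) powr p + vnorm (X n) (x n) powr p)"
        unfolding c_def by (intro sum_mono powr_tangent p X.norm_nonneg zn xn)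
      also have "\<dots> = (p - 1) * s + (\<Sum>n<N. vnorm (X n) (x n) powr p)"
        by (simp add: s_def sum.distrib sum_distrib_left)
      also have "(\<Sum>n<N. vnorm (X n) (x n) powr p) \<le> vnorm Y x powr p"
        unfolding norm_powr [OF x] using x by (intro sum_le_suminf) (auto simp: in_carrier)
      also have "\<dots> \<le> B powr p"
        using p B [OF xK] Y.norm_nonneg [OF x] by (intro powr_mono2) auto
      finally show "norm (G x) \<le> ((p - 1) * s + B powr p) / p"
        using p by (simp add: pos_le_divide_eq mult.commute)
    qed
    moreover have "G z = of_real s"
      unfolding G_def s_def of_real_sum
      using powr_times_self [OF X.norm_nonneg [OF zn]]
      by (simp add: h(3) c_def flip: of_real_mult)
    moreover have "0 \<le> s"
      by (simp add: s_def sum_nonneg)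
    ultimately have "p * s \<le> (p - 1) * s + B powr p"
      using p by (simp add: pos_le_divide_eq mult.commute)
    then show ?thesis
      by (simp add: s_def algebra_simps)
  qed
  then have "summable (\<lambda>n. vnorm (X n) (z n) powr p)"
    by (intro summableI_nonneg_bounded) auto
  then show "z \<in> vcarrier Y"
    using zn by (simp add: in_carrier)
qed

text \<open>The coordinatewise closure \<open>S\<close> of \<open>K\<close> is compact by Tychonoff's theorem. On \<open>S\<close> every functional
  is a uniform limit of its finite partial sums over the coordinates, since the estimate of the
  tails on \<open>K\<close> passes to \<open>S\<close>. These partial sums are coordinatewise continuous, so on \<open>S\<close> the weak
  topology is no finer than the coordinatewise one; thus \<open>S\<close> is weakly compact and equals the weak
  closure of \<open>K\<close>.\<close>

lemma relatively_weakly_compact_lp_sum: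
  assumes K: "p_Vstar_set p Y K"
    and compact: "\<And>n. relatively_weakly_compact (X n) ((\<lambda>x. x n) ` K)"
  shows "relatively_weakly_compact Y K"
proof -
  have KY: "K \<subseteq> vcarrier Y"
    using K by (simp add: p_Vstar_set_def)
  define S where "S = coordinatewise closure_of K"
  have SY: "S \<subseteq> vcarrier Y"
    using K coordinatewise_closure_subset [OF KY] unfolding S_def p_Vstar_set_def by blast
  have S_top: "S \<subseteq> topspace coordinatewise"
    unfolding S_def by (rule closure_of_subset_topspace)
  have K_top: "K \<subseteq> topspace coordinatewise"
    using KY topspace_coordinatewise coordinate_in_carrier by blast
  have KS: "K \<subseteq> S"
    unfolding S_def by (rule closure_of_subset [OF K_top])
  define C where "C n = weak_topology (X n) closure_of ((\<lambda>x. x n) ` K)" for n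
  have "compactin coordinatewise (PiE UNIV C)"
    using compact by (auto simp: compactin_PiE C_def relatively_weakly_compact_def)
  moreover have "S \<subseteq> PiE UNIV C"
    unfolding S_def C_def using in_product_topology_closure_of by fastforce
  ultimately have "compactin coordinatewise S"
    by (rule closed_compactin) (simp add: S_def)
  then have compact_S: "compactin (subtopology coordinatewise S) S"
    by (simp add: compactin_subtopology)
  have "continuous_map (subtopology coordinatewise S) euclidean f"
    if f: "f \<in> vcarrier (dual Y)" for f
  proof -
    have tail: "\<exists>N. \<forall>M\<ge>N. \<forall>x\<in>S. norm (f x - (\<Sum>n<M. f (summand_embed X n (x n)))) \<le> e"
      if "0 < e" for e
    proof -
      obtain N where N: "\<And>M L x. N \<le> M \<Longrightarrow> x \<in> K \<Longrightarrow> norm (\<Sum>n=M..<L. f (summand_embed X n (x n))) \<le> e"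
        using uniform_tails [OF K f \<open>0 < e\<close>] by blast
      have "norm (f x - (\<Sum>n<M. f (summand_embed X n (x n)))) \<le> e" if M: "N \<le> M" and x: "x \<in> S" for M x
      proof (rule Lim_norm_ubound)
        have "x \<in> vcarrier Y"
          using x SY by blast
        then show "(\<lambda>L. (\<Sum>n<L. f (summand_embed X n (x n))) - (\<Sum>n<M. f (summand_embed X n (x n))))
            \<longlonglongrightarrow> f x - (\<Sum>n<M. f (summand_embed X n (x n)))"
          using functional_sums [OF f] by (intro tendsto_diff tendsto_const) (simp add: sums_def)
        have "norm (\<Sum>n=M..<L. f (summand_embed X n (x n))) \<le> e" for L
          by (rule norm_le_on_closure [OF continuous_map_block [OF f] N [OF M]])
            (use x in \<open>simp_all add: S_def\<close>)
        moreover have "(\<Sum>n<L. f (summand_embed X n (x n))) - (\<Sum>n<M. f (summand_embed X n (x n)))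
            = (\<Sum>n=M..<L. f (summand_embed X n (x n)))" if "M \<le> L" for L
          using that by (simp add: sum_diff_nat_ivl lessThan_atLeast0)
        ultimately show "\<forall>\<^sub>F L in sequentially.
            norm ((\<Sum>n<L. f (summand_embed X n (x n))) - (\<Sum>n<M. f (summand_embed X n (x n)))) \<le> e"
          by (auto intro!: eventually_sequentiallyI [of M])
      qed simp
      then show ?thesis by blast
    qed
    have "continuous_map (subtopology coordinatewise S) Met_TC.mtopology f"
    proof (rule Met_TC.continuous_map_uniform_limit [where F = sequentially])
      show "\<forall>\<^sub>F M in sequentially. continuous_map (subtopology coordinatewise S) Met_TC.mtopology
          (\<lambda>x. \<Sum>n<M. f (summand_embed X n (x n)))"
        by (auto intro!: always_eventually continuous_map_from_subtopology continuous_map_block f)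
      fix e :: real assume "0 < e"
      then obtain N where "\<forall>M\<ge>N. \<forall>x\<in>S. norm (f x - (\<Sum>n<M. f (summand_embed X n (x n)))) \<le> e / 2"
        using tail [of "e / 2"] by auto
      then show "\<forall>\<^sub>F M in sequentially. \<forall>x\<in>topspace (subtopology coordinatewise S).
          f x \<in> UNIV \<and> dist (\<Sum>n<M. f (summand_embed X n (x n))) (f x) < e"
        using \<open>0 < e\<close> by (intro eventually_sequentiallyI [of N]) (force simp: dist_norm norm_minus_commute)
    qed simp
    then show ?thesis by simp
  qed
  then have cont: "continuous_map (subtopology coordinatewise S) (weak_topology Y) id"
    using SY by (intro Y.continuous_map_into_weak) (auto simp del: topspace_product_topology)
  have "continuous_map (weak_topology Y) coordinatewise id"
    unfolding continuous_map_componentwise_UNIV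
    using YX.continuous_map_weak_weak [OF bounded_operator_coordinate] by simp
  from continuous_map_image_closure_subset [OF this, of K]
  have "weak_topology Y closure_of K \<subseteq> S"
    by (simp add: S_def)
  moreover have "S \<subseteq> weak_topology Y closure_of K"
    using continuous_map_image_closure_subset [OF cont, of K] KS
    by (simp add: closure_of_subtopology S_def inf_absorb2)
  ultimately have "weak_topology Y closure_of K = S"
    by (rule antisym)
  moreover have "compactin (weak_topology Y) S"
    using image_compactin [OF compact_S cont] by simp
  ultimately show ?thesis
    using KY by (simp add: relatively_weakly_compact_def)
qed

text \<open>As the coordinate map is a left inverse of the embedding and both are weakly continuous, the
  weak closure of \<open>K\<close> is exactly the image of the weak closure of the embedded set.\<close>

lemma relatively_weakly_compact_coordinate:
  assumes K: "K \<subseteq> vcarrier (X n)" and compact: "relatively_weakly_compact Y (summand_embed X n ` K)"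
  shows "relatively_weakly_compact (X n) K"
proof -
  let ?C = "weak_topology Y closure_of (summand_embed X n ` K)"
  have coord: "continuous_map (weak_topology Y) (weak_topology (X n)) (\<lambda>x. x n)"
    by (rule YX.continuous_map_weak_weak [OF bounded_operator_coordinate])
  have embed: "continuous_map (weak_topology (X n)) (weak_topology Y) (summand_embed X n)"
    by (rule XY.continuous_map_weak_weak [OF bounded_operator_embed])
  have [simp]: "summand_embed X n y n = y" for y
    by (simp add: summand_embed_def)
  have "(\<lambda>x. x n) ` ?C = weak_topology (X n) closure_of K"
  proof
    show "(\<lambda>x. x n) ` ?C \<subseteq> weak_topology (X n) closure_of K"
      using continuous_map_image_closure_subset [OF coord, of "summand_embed X n ` K"]
      by (simp add: image_image)
    show "weak_topology (X n) closure_of K \<subseteq> (\<lambda>x. x n) ` ?C"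
    proof
      fix y assume "y \<in> weak_topology (X n) closure_of K"
      then have "summand_embed X n y \<in> ?C"
        using continuous_map_image_closure_subset [OF embed, of K] by blast
      then show "y \<in> (\<lambda>x. x n) ` ?C"
        by (rule rev_image_eqI) simp
    qed
  qed
  then show ?thesis
    using image_compactin [OF _ coord, of ?C] K compact by (simp add: relatively_weakly_compact_def)
qed

end

theorem theorem3p10:
  fixes X :: "nat \<Rightarrow> ('k::rc_field, 'a) nspace" and p :: real
  assumes "\<And>n. banach_space (X n)"
    and "1 \<le> p"
  shows "property_p_Vstar p (lp_sum p X) \<longleftrightarrow> (\<forall>n. property_p_Vstar p (X n))"
proof -
  interpret normed_space_sequence X p
    using assms by (simp add: normed_space_sequence_def banach_space_def)
  show ?thesis
    unfolding property_p_Vstar_def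
  proof (intro iffI allI impI)
    fix n K
    assume "\<forall>K. p_Vstar_set p Y K \<longrightarrow> relatively_weakly_compact Y K" and K: "p_Vstar_set p (X n) K"
    then have "relatively_weakly_compact Y (summand_embed X n ` K)"
      using XY.p_Vstar_set_image [OF bounded_operator_embed] by blast
    then show "relatively_weakly_compact (X n) K"
      using K by (intro relatively_weakly_compact_coordinate) (auto simp: p_Vstar_set_def)
  next
    fix K
    assume "\<forall>n K. p_Vstar_set p (X n) K \<longrightarrow> relatively_weakly_compact (X n) K"
      and K: "p_Vstar_set p Y K"
    then show "relatively_weakly_compact Y K"
      using YX.p_Vstar_set_image [OF bounded_operator_coordinate]
      by (intro relatively_weakly_compact_lp_sum) auto
  qed
qed

end
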